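(* Let $a,b$ be real numbers with $a>\tfrac14$, $b\ge 0$ and $3a+2b<1$. Let $C_1,C_2$ be independent random Cantor sets, each having the same distribution as Larsson's random Cantor set $C_{a,b}$. Then, almost surely, the algebraic difference $C_2-C_1=\{y-x : x\in C_1,\ y\in C_2\}$ contains an interval (of positive length).
   Context: Definition of Larsson's random Cantor set $C_{a,b}$. Put $\mathbf g:=\frac{1-3a-2b}{2}>0$. Let $(U_w)$, indexed by the nonempty finite words $w$ over $\{1,2\}$, be i.i.d. random variables uniformly distributed on $[0,\mathbf g]$. Define random intervals $J_w$ of length $a^{|w|}$ recursively: $J_{\emptyset}=[0,1]$ and, if $|w|=n$ and $J_w=[s,s+a^n]$, then $J_{w1}$ is the interval of length $a^{n+1}$ with left endpoint $s+a^n(b+U_{w1})$ and $J_{w2}$ is the interval of length $a^{n+1}$ with left endpoint $s+a^n\left(\frac{1+a}{2}+U_{w2}\right)$. Put $C_{a,b}^n=\bigcup_{|w|=n}J_w$ and $C_{a,b}=\bigcap_{n\ge1}C_{a,b}^n$. *)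

theory Defs
  imports "HOL-Probability.Probability"
begin

text \<open>The space of compact sets with the \<open>\<sigma>\<close>-algebra generated by the hitting events
  \<open>K \<inter> G \<noteq> {}\<close>, \<open>G\<close> open.  This is the usual \<open>\<sigma>\<close>-algebra of random compact sets; over a
  separable metric space it is the Borel \<open>\<sigma>\<close>-algebra of the Hausdorff metric.\<close>

definition compacts :: "'a :: topological_space set measure" where
  "compacts = sigma {K. compact K} {{K. compact K \<and> K \<inter> G \<noteq> {}} | G. open G}"

text \<open>A word is stored with its last letter first: the word \<open>w\<close> extended on the right by the
  letter \<open>i\<close> is the list \<open>i # w\<close>.\<close>

definition words :: "nat list set" where
  "words = lists {1, 2}"

definition larsson_gap :: "real \<Rightarrow> real \<Rightarrow> real" where
  "larsson_gap a b = (1 - 3 * a - 2 * b) / 2"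

primrec larsson_left :: "real \<Rightarrow> real \<Rightarrow> (nat list \<Rightarrow> real) \<Rightarrow> nat list \<Rightarrow> real" where
  "larsson_left a b u [] = 0"
| "larsson_left a b u (i # w) =
     larsson_left a b u w + a ^ length w * ((if i = 1 then b else (1 + a) / 2) + u (i # w))"

definition larsson_interval :: "real \<Rightarrow> real \<Rightarrow> (nat list \<Rightarrow> real) \<Rightarrow> nat list \<Rightarrow> real set" where
  "larsson_interval a b u w = {larsson_left a b u w .. larsson_left a b u w + a ^ length w}"

definition larsson_level :: "real \<Rightarrow> real \<Rightarrow> (nat list \<Rightarrow> real) \<Rightarrow> nat \<Rightarrow> real set" where
  "larsson_level a b u n = (\<Union>w\<in>{w \<in> words. length w = n}. larsson_interval a b u w)"

definition larsson_set :: "real \<Rightarrow> real \<Rightarrow> (nat list \<Rightarrow> real) \<Rightarrow> real set" where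
  "larsson_set a b u = (\<Inter>n\<in>{1..}. larsson_level a b u n)"

text \<open>The joint law of the i.i.d. family \<open>U\<close>, indexed by the nonempty words.\<close>

definition larsson_shifts :: "real \<Rightarrow> real \<Rightarrow> (nat list \<Rightarrow> real) measure" where
  "larsson_shifts a b =
     (\<Pi>\<^sub>M w\<in>words - {[]}. uniform_measure lborel {0 .. larsson_gap a b})"

definition larsson_law :: "real \<Rightarrow> real \<Rightarrow> real set measure" where
  "larsson_law a b = distr (larsson_shifts a b) compacts (larsson_set a b)"

text \<open>The law is well defined: the random set is measurable.\<close>

lemma finite_words: "finite {w \<in> words. length w = n}"
proof -
  have "{w \<in> words. length w = n} = {w. set w \<subseteq> {1, 2} \<and> length w = n}"
    by (auto simp: words_def lists_eq_set)
  then show ?thesis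
    by (simp add: finite_lists_length_eq)
qed

lemma compact_larsson_level: "compact (larsson_level a b u n)"
  unfolding larsson_level_def larsson_interval_def
  by (intro compact_UN finite_words) auto

lemma compact_larsson_set: "compact (larsson_set a b u)"
proof -
  have "larsson_set a b u = larsson_level a b u 1 \<inter> (\<Inter>n\<in>{1..}. larsson_level a b u n)"
    by (auto simp: larsson_set_def)
  also have "compact \<dots>"
    by (intro compact_Int_closed closed_INT ballI compact_imp_closed compact_larsson_level)
  finally show ?thesis .
qed

lemma measurable_larsson_left:
  "w \<in> words \<Longrightarrow> (\<lambda>u. larsson_left a b u w) \<in> borel_measurable (larsson_shifts a b)"
proof (induction w)
  case (Cons i w)
  have "(\<lambda>u. u (i # w)) \<in> larsson_shifts a b \<rightarrow>\<^sub>M uniform_measure lborel {0 .. larsson_gap a b}"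
    unfolding larsson_shifts_def using Cons.prems by (intro measurable_component_singleton) auto
  then have [measurable]: "(\<lambda>u. u (i # w)) \<in> borel_measurable (larsson_shifts a b)"
    by (simp cong: measurable_cong_sets)
  have [measurable]: "(\<lambda>u. larsson_left a b u w) \<in> borel_measurable (larsson_shifts a b)"
    using Cons by (auto simp: words_def)
  show ?case by simp
qed simp

lemma pred_larsson_levels_hit:
  assumes "l \<in> borel_measurable (larsson_shifts a b)" "r \<in> borel_measurable (larsson_shifts a b)"
  shows "Measurable.pred (larsson_shifts a b)
    (\<lambda>u. \<exists>x. l u \<le> x \<and> x \<le> r u \<and> (\<forall>n\<in>{1..N}. x \<in> larsson_level a b u n))"
  using assms
proof (induction N arbitrary: l r)
  case 0
  have "(\<lambda>u. \<exists>x. l u \<le> x \<and> x \<le> r u) = (\<lambda>u. l u \<le> r u)"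
    by (auto intro: order_trans)
  moreover have "Measurable.pred (larsson_shifts a b) (\<lambda>u. l u \<le> r u)"
    unfolding pred_def by (intro borel_measurable_le "0.prems")
  ultimately show ?case by simp
next
  case (Suc N)
  let ?L = "\<lambda>w u. max (l u) (larsson_left a b u w)"
  let ?R = "\<lambda>w u. min (r u) (larsson_left a b u w + a ^ length w)"
  let ?W = "{w \<in> words. length w = Suc N}"
  have "Measurable.pred (larsson_shifts a b)
    (\<lambda>u. \<exists>x. ?L w u \<le> x \<and> x \<le> ?R w u \<and> (\<forall>n\<in>{1..N}. x \<in> larsson_level a b u n))"
    if "w \<in> ?W" for w
  proof -
    have "(\<lambda>u. larsson_left a b u w) \<in> borel_measurable (larsson_shifts a b)"
      using that by (intro measurable_larsson_left) auto
    then show ?thesis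
      by (intro Suc.IH borel_measurable_max borel_measurable_min borel_measurable_add Suc.prems) auto
  qed
  then have "Measurable.pred (larsson_shifts a b)
    (\<lambda>u. \<exists>w\<in>?W. \<exists>x. ?L w u \<le> x \<and> x \<le> ?R w u \<and> (\<forall>n\<in>{1..N}. x \<in> larsson_level a b u n))"
    by (intro pred_intros_finite(4) finite_words) auto
  also have "(\<lambda>u. \<exists>w\<in>?W. \<exists>x. ?L w u \<le> x \<and> x \<le> ?R w u
        \<and> (\<forall>n\<in>{1..N}. x \<in> larsson_level a b u n))
    = (\<lambda>u. \<exists>x. l u \<le> x \<and> x \<le> r u \<and> (\<forall>n\<in>{1..Suc N}. x \<in> larsson_level a b u n))"
    (is "?P = ?Q")
  proof
    fix u
    have *: "x \<in> larsson_level a b u (Suc N) \<longleftrightarrow> (\<exists>w\<in>?W. larsson_left a b u w \<le> x \<and>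
        x \<le> larsson_left a b u w + a ^ length w)" for x
      by (simp only: larsson_level_def larsson_interval_def UN_iff atLeastAtMost_iff)
    have **: "(\<forall>n\<in>{1..Suc N}. x \<in> larsson_level a b u n) \<longleftrightarrow>
        x \<in> larsson_level a b u (Suc N) \<and> (\<forall>n\<in>{1..N}. x \<in> larsson_level a b u n)" for x
      by (simp add: atLeastAtMostSuc_conv)
    show "?P u = ?Q u"
      unfolding ** * max.bounded_iff min.bounded_iff by blast
  qed
  finally show ?case .
qed

lemma larsson_set_hits_interval:
  "larsson_set a b u \<inter> {p..q} \<noteq> {} \<longleftrightarrow>
     (\<forall>N. \<exists>x. p \<le> x \<and> x \<le> q \<and> (\<forall>n\<in>{1..N}. x \<in> larsson_level a b u n))"
proof
  assume R: "\<forall>N. \<exists>x. p \<le> x \<and> x \<le> q \<and> (\<forall>n\<in>{1..N}. x \<in> larsson_level a b u n)"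
  have "{p..q} \<inter> (\<Inter>n\<in>{1..}. larsson_level a b u n) \<noteq> {}"
  proof (rule compact_imp_fip_image)
    fix I :: "nat set" assume I: "finite I" "I \<subseteq> {1..}"
    obtain N where "I \<subseteq> {..N}"
      using I(1) by (auto simp: finite_nat_set_iff_bounded_le)
    with I(2) have "I \<subseteq> {1..N}" by auto
    moreover obtain x where "p \<le> x" "x \<le> q" "\<forall>n\<in>{1..N}. x \<in> larsson_level a b u n"
      using R by blast
    ultimately have "x \<in> {p..q} \<inter> (\<Inter>n\<in>I. larsson_level a b u n)" by auto
    then show "{p..q} \<inter> (\<Inter>n\<in>I. larsson_level a b u n) \<noteq> {}" by blast
  qed (auto intro: compact_imp_closed compact_larsson_level)
  then show "larsson_set a b u \<inter> {p..q} \<noteq> {}"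
    by (auto simp: larsson_set_def)
next
  assume "larsson_set a b u \<inter> {p..q} \<noteq> {}"
  then obtain x where "p \<le> x" "x \<le> q" "\<forall>n\<in>{1..}. x \<in> larsson_level a b u n"
    by (auto simp: larsson_set_def)
  then show "\<forall>N. \<exists>x. p \<le> x \<and> x \<le> q \<and> (\<forall>n\<in>{1..N}. x \<in> larsson_level a b u n)"
    by (intro allI exI[of _ x]) auto
qed

lemma open_real_eq_rat_intervals:
  fixes G :: "real set"
  assumes "open G"
  shows "G = (\<Union>(p, q)\<in>{(p, q). {real_of_rat p .. real_of_rat q} \<subseteq> G}. {real_of_rat p .. real_of_rat q})"
proof (intro equalityI subsetI)
  fix x assume "x \<in> G"
  then obtain e where e: "e > 0" "cball x e \<subseteq> G"
    using assms open_contains_cball by blast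
  obtain p where p: "x - e < real_of_rat p" "real_of_rat p < x"
    using of_rat_dense[of "x - e" x] e by auto
  obtain q where q: "x < real_of_rat q" "real_of_rat q < x + e"
    using of_rat_dense[of x "x + e"] e by auto
  have "{real_of_rat p .. real_of_rat q} \<subseteq> cball x e"
    using p q by (auto simp: cball_eq_atLeastAtMost)
  with e(2) have "(p, q) \<in> {(p, q). {real_of_rat p .. real_of_rat q} \<subseteq> G}"
    by blast
  moreover have "x \<in> {real_of_rat p .. real_of_rat q}"
    using p q by simp
  ultimately show "x \<in> (\<Union>(p, q)\<in>{(p, q). {real_of_rat p .. real_of_rat q} \<subseteq> G}.
      {real_of_rat p .. real_of_rat q})"
    by blast
qed auto

lemma larsson_set_measurable: "larsson_set a b \<in> larsson_shifts a b \<rightarrow>\<^sub>M compacts"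
  unfolding compacts_def
proof (rule measurable_measure_of)
  fix A assume "A \<in> {{K. compact K \<and> K \<inter> G \<noteq> {}} | G. open (G :: real set)}"
  then obtain G :: "real set" where G: "open G" "A = {K. compact K \<and> K \<inter> G \<noteq> {}}" by auto
  define I where "I = {(p, q). {real_of_rat p .. real_of_rat q} \<subseteq> G}"
  have [measurable]: "Measurable.pred (larsson_shifts a b)
      (\<lambda>u. larsson_set a b u \<inter> {p..q} \<noteq> {})" for p q
    unfolding larsson_set_hits_interval
    by (intro pred_intros_countable(1) pred_larsson_levels_hit) auto
  have "Measurable.pred (larsson_shifts a b)
      (\<lambda>u. \<exists>i\<in>I. larsson_set a b u \<inter> {real_of_rat (fst i) .. real_of_rat (snd i)} \<noteq> {})"
    by (intro measurable_pred_countable(2)) auto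
  then have "{u \<in> space (larsson_shifts a b).
      \<exists>i\<in>I. larsson_set a b u \<inter> {real_of_rat (fst i) .. real_of_rat (snd i)} \<noteq> {}}
      \<in> sets (larsson_shifts a b)"
    by measurable
  also have "{u \<in> space (larsson_shifts a b).
      \<exists>i\<in>I. larsson_set a b u \<inter> {real_of_rat (fst i) .. real_of_rat (snd i)} \<noteq> {}}
    = larsson_set a b -` A \<inter> space (larsson_shifts a b)"
  proof -
    have "G = (\<Union>i\<in>I. {real_of_rat (fst i) .. real_of_rat (snd i)})"
      using open_real_eq_rat_intervals[OF G(1)] unfolding I_def by (simp add: case_prod_unfold)
    then have "larsson_set a b u \<inter> G \<noteq> {} \<longleftrightarrow>
        (\<exists>i\<in>I. larsson_set a b u \<inter> {real_of_rat (fst i) .. real_of_rat (snd i)} \<noteq> {})" for u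
      by blast
    moreover have "larsson_set a b -` A = {u. larsson_set a b u \<inter> G \<noteq> {}}"
      by (simp add: G(2) compact_larsson_set vimage_def)
    ultimately show ?thesis
      by (simp only:) blast
  qed
  finally show "larsson_set a b -` A \<inter> space (larsson_shifts a b) \<in> sets (larsson_shifts a b)" .
qed (auto simp: compact_larsson_set)

lemma prob_space_larsson_law:
  assumes "larsson_gap a b > 0"
  shows "prob_space (larsson_law a b)"
proof -
  have "prob_space (uniform_measure lborel {0 .. larsson_gap a b})"
    using assms by (intro prob_space_uniform_measure) auto
  then have "prob_space (larsson_shifts a b)"
    unfolding larsson_shifts_def by (intro prob_space_PiM)
  then show ?thesis
    unfolding larsson_law_def by (rule prob_space.prob_space_distr[OF _ larsson_set_measurable])
qed

end

theory Submission
  imports Defs "HOL-Real_Asymp.Real_Asymp"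
begin

text \<open>A point \<open>t\<close> lies in \<open>C\<^sub>2 - C\<^sub>1\<close> iff the line \<open>y = x + t\<close> meets the random product set
\<open>C\<^sub>1 \<times> C\<^sub>2\<close>, which is cut out by the squares \<open>J\<^sub>v \<times> J\<^sub>w\<close> with \<open>|v| = |w| = n\<close>.  What matters about a
square is the normalised position \<open>\<tau> = (t - l\<^sub>w + l\<^sub>v) / a\<^sup>n\<close> of the line relative to it (\<open>l\<close> denotes left
endpoints): the line crosses the interior iff \<open>|\<tau>| < 1\<close>.

The expected number of squares of level \<open>n\<close> on the line grows like \<open>(4 a)\<^sup>n\<close>, and \<open>4 a > 1\<close>.  To turn
this into a martingale, weight every square by \<open>h \<tau>\<close>, where \<open>h\<close> is the expected density of the
difference of the two natural measures.  It satisfies \<open>E (\<Sum> h (\<tau>\<^sub>i\<^sub>j)) = 4 a h \<tau>\<close>, the sum being over the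
four children (\<open>nn_integral_offspring_dens\<close>).  Hence for each fixed \<open>t\<close>

  \<open>X\<^sub>n t = (4 a)\<^sup>-\<^sup>n \<Sum>\<^sub>v\<^sub>,\<^sub>w h ((t - l\<^sub>w + l\<^sub>v) / a\<^sup>n)\<close>

(\<open>dens n u u' t\<close> below) is a nonnegative martingale.  It is also deterministically a probability density
in \<open>t\<close>, so that it cannot degenerate for all \<open>t\<close> at once, and \<open>X\<^sub>n t > 0\<close> for all large \<open>n\<close> forces
\<open>t \<in> C\<^sub>2 - C\<^sub>1\<close>.  So it suffices to show that from some level on \<open>X\<^sub>n\<close> loses only a small fraction of
\<open>1 + X\<^sub>n\<close>, simultaneously for all \<open>t\<close>.

The loss is controlled by an exponential moment (\<open>nn_integral_tilt_le\<close>): for a constant \<open>c\<close> and all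
\<open>s \<ge> 0\<close>,

  \<open>E exp (s (X\<^sub>n t - X\<^sub>n\<^sub>+\<^sub>1 t) - c s\<^sup>2 (4 a)\<^sup>-\<^sup>n X\<^sub>n t) \<le> 1\<close>.

It is proved by induction on \<open>n\<close>, splitting both families of shifts at the root of the tree: \<open>X\<^sub>n\<^sub>+\<^sub>1 t\<close> is
\<open>(4 a)\<^sup>-\<^sup>1\<close> times the sum of \<open>X\<^sub>n (\<tau>\<^sub>i\<^sub>j)\<close> over the four first generation squares.  The factors belonging to these
squares are not independent in general, because squares in one row or column share shifts.  But the gap between \<open>J\<^sub>w\<^sub>1\<close>
and \<open>J\<^sub>w\<^sub>2\<close> is never shorter than these intervals, so a line crosses the two diagonal squares at most, or a single
off-diagonal one (\<open>live_exclusive\<close>).  The two diagonal squares involve disjoint sets of shifts, and the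
expectation factorises.

With \<open>s\<close> of order \<open>(4 a)\<^sup>n\<^sup>/\<^sup>2\<close> the probability of a loss exceeding a geometrically small fraction is doubly
exponentially small.  Since \<open>X\<^sub>n\<close> is Lipschitz with a constant that grows only exponentially, a union
bound over exponentially many points and the Borel-Cantelli lemma give the uniform statement
(\<open>dens_Suc_lower\<close>, \<open>AE_eventually_no_deficit\<close>).  Finally the almost sure statement about the shifts is
transferred to random sets with the prescribed laws, for which the event has to be a measurable set of
pairs of compact sets.\<close>

section \<open>Preliminaries\<close>

lemma nn_integral_pair_mult:
  assumes "sigma_finite_measure N"
    and [measurable]: "f \<in> borel_measurable M" "f' \<in> borel_measurable N"
  shows "(\<integral>\<^sup>+p. f (fst p) * f' (snd p) \<partial>(M \<Otimes>\<^sub>M N)) = (\<integral>\<^sup>+x. f x \<partial>M) * (\<integral>\<^sup>+y. f' y \<partial>N)"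
proof -
  interpret N: sigma_finite_measure N by fact
  show ?thesis
    by (simp add: N.nn_integral_fst[symmetric] nn_integral_cmult nn_integral_multc)
qed

lemma nn_integral_double_sum_cmult:
  assumes "\<And>i j. f i j \<in> borel_measurable M"
  shows "(\<integral>\<^sup>+x. (\<Sum>i\<in>I. \<Sum>j\<in>J. c * f i j x) \<partial>M) = (\<Sum>i\<in>I. \<Sum>j\<in>J. c * (\<integral>\<^sup>+x. f i j x \<partial>M))"
  using assms by (simp add: nn_integral_sum nn_integral_cmult)

text \<open>Being valid for every nonnegative \<open>x\<close>, this allows exponential moments of arbitrary order for the
lower tail of a nonnegative variable; the upper tail would need a restriction on \<open>s\<close>.\<close>

lemma exp_minus_le_quadratic:
  fixes x :: real
  assumes "0 \<le> x"
  shows "exp (- x) \<le> 1 - x + x\<^sup>2 / 2"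
proof -
  define f where "f = (\<lambda>x :: real. 1 - x + x\<^sup>2 / 2 - exp (- x))"
  have "f 0 \<le> f x"
  proof (rule DERIV_nonneg_imp_nondecreasing[OF assms])
    fix y :: real assume "0 \<le> y"
    have "(f has_real_derivative (- 1 + y + exp (- y))) (at y)"
      unfolding f_def by (auto intro!: derivative_eq_intros)
    moreover have "0 \<le> - 1 + y + exp (- y)"
      using exp_ge_add_one_self[of "- y"] by simp
    ultimately show "\<exists>D. (f has_real_derivative D) (at y) \<and> 0 \<le> D" by blast
  qed
  then show ?thesis by (simp add: f_def)
qed

definition contains_interval :: "real set \<times> real set \<Rightarrow> bool" where
  "contains_interval K \<longleftrightarrow> (\<exists>c d. c < d \<and> {c..d} \<subseteq> {y - x | x y. x \<in> fst K \<and> y \<in> snd K})"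

section \<open>The triangular density of a difference of shifts\<close>

locale larsson =
  fixes a b :: real
  assumes a_gt: "1 / 4 < a" and b_nonneg: "0 \<le> b" and a_b_less: "3 * a + 2 * b < 1"
begin

abbreviation g :: real where "g \<equiv> larsson_gap a b"

lemma a_pos: "0 < a" and a_less_third: "a < 1 / 3"
  using a_gt b_nonneg a_b_less by auto

lemma g_pos: "0 < g"
  using a_b_less by (simp add: larsson_gap_def)

lemma g_eq: "2 * g = 1 - 3 * a - 2 * b"
  by (simp add: larsson_gap_def)

definition unif :: "real measure" where
  "unif = uniform_measure lborel {0..g}"

lemma sets_unif [measurable_cong, simp]: "sets unif = sets borel"
  by (simp add: unif_def)

lemma space_unif [simp]: "space unif = UNIV"
  by (simp add: unif_def)

lemma prob_space_unif: "prob_space unif"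
  unfolding unif_def using g_pos by (intro prob_space_uniform_measure) auto

lemma AE_unif: "AE x in unif. 0 \<le> x \<and> x \<le> g"
  unfolding unif_def by (rule AE_uniform_measureI) auto

lemma nn_integral_unif:
  assumes [measurable]: "F \<in> borel_measurable borel"
  shows "(\<integral>\<^sup>+x. F x \<partial>unif) = ennreal (1 / g) * (\<integral>\<^sup>+x. F x * indicator {0..g} x \<partial>lborel)"
proof -
  have "inverse (ennreal g) = ennreal (1 / g)"
    using g_pos by (simp add: inverse_ennreal inverse_eq_divide)
  then show ?thesis
    unfolding unif_def using g_pos
    by (subst nn_integral_uniform_measure) (auto simp: divide_ennreal_def mult.commute)
qed

definition tri :: "real \<Rightarrow> real" where
  "tri z = max 0 (g - \<bar>z\<bar>) / g\<^sup>2"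

lemma tri_nonneg: "0 \<le> tri z"
  by (simp add: tri_def)

lemma tri_le: "tri z \<le> 1 / g"
proof -
  have "max 0 (g - \<bar>z\<bar>) / g\<^sup>2 \<le> g / g\<^sup>2"
    using g_pos by (intro divide_right_mono) auto
  also have "g / g\<^sup>2 = 1 / g"
    using g_pos by (simp add: power2_eq_square)
  finally show ?thesis by (simp add: tri_def)
qed

lemma tri_eq_0: "g \<le> \<bar>z\<bar> \<Longrightarrow> tri z = 0"
  by (simp add: tri_def)

lemma tri_lipschitz: "\<bar>tri x - tri y\<bar> \<le> \<bar>x - y\<bar> / g\<^sup>2"
proof -
  have "tri x - tri y = (max 0 (g - \<bar>x\<bar>) - max 0 (g - \<bar>y\<bar>)) / g\<^sup>2"
    by (simp add: tri_def diff_divide_distrib)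
  then have "\<bar>tri x - tri y\<bar> = \<bar>max 0 (g - \<bar>x\<bar>) - max 0 (g - \<bar>y\<bar>)\<bar> / g\<^sup>2"
    by simp
  also have "\<dots> \<le> \<bar>x - y\<bar> / g\<^sup>2"
    by (intro divide_right_mono) auto
  finally show ?thesis .
qed

lemma measurable_tri [measurable]: "tri \<in> borel_measurable borel"
  unfolding tri_def by measurable

text \<open>The interval \<open>{0..g}\<close> meets its translate by \<open>- z\<close> in an interval of length \<open>max 0 (g - \<bar>z\<bar>)\<close>, so \<open>tri\<close> is the
density of the difference of two independent shifts.\<close>

lemma nn_integral_unif_diff:
  assumes [measurable]: "F \<in> borel_measurable borel"
  shows "(\<integral>\<^sup>+x. \<integral>\<^sup>+x'. F (x' - x) \<partial>unif \<partial>unif) = (\<integral>\<^sup>+z. ennreal (tri z) * F z \<partial>lborel)"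
proof -
  let ?I = "indicator {0..g} :: real \<Rightarrow> ennreal" and ?c = "ennreal (1 / g)"
  \<comment> \<open>The factor \<open>?c * ?c\<close> normalises the two uniform laws.\<close>
  have overlap: "?c * ?c * (\<integral>\<^sup>+x. ?I (x + z) * ?I x \<partial>lborel) = ennreal (tri z)" for z
  proof -
    have "(\<integral>\<^sup>+x. ?I (x + z) * ?I x \<partial>lborel) = (\<integral>\<^sup>+x. indicator {max 0 (- z)..min g (g - z)} x \<partial>lborel)"
      by (intro nn_integral_cong) (auto simp: indicator_def)
    also have "\<dots> = emeasure lborel {max 0 (- z)..min g (g - z)}"
      by simp
    also have "\<dots> = ennreal (max 0 (g - \<bar>z\<bar>))"
      by (cases "max 0 (- z) \<le> min g (g - z)")
        (auto intro!: arg_cong[where f = ennreal] simp: max_def min_def abs_if split: if_splits)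
    finally have "?c * ?c * (\<integral>\<^sup>+x. ?I (x + z) * ?I x \<partial>lborel)
        = ennreal (1 / g * (1 / g) * max 0 (g - \<bar>z\<bar>))"
      using g_pos by (simp only: ennreal_mult' divide_nonneg_nonneg zero_le_one less_imp_le max.cobounded1 mult_nonneg_nonneg)
    also have "1 / g * (1 / g) * max 0 (g - \<bar>z\<bar>) = tri z"
      by (simp add: tri_def power2_eq_square)
    finally show ?thesis .
  qed
  have "(\<integral>\<^sup>+x. \<integral>\<^sup>+x'. F (x' - x) \<partial>unif \<partial>unif)
      = ?c * (\<integral>\<^sup>+x. ?c * (\<integral>\<^sup>+x'. F (x' - x) * ?I x' \<partial>lborel) * ?I x \<partial>lborel)"
    by (subst nn_integral_unif)
      (auto simp: nn_integral_unif intro!: nn_integral_cong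
        borel_measurable_subalgebra sigma_finite_measure.borel_measurable_nn_integral
        lborel.borel_measurable_nn_integral)
  also have "\<dots> = ?c * (\<integral>\<^sup>+x. ?c * (\<integral>\<^sup>+z. F z * ?I (x + z) \<partial>lborel) * ?I x \<partial>lborel)"
  proof -
    have "(\<integral>\<^sup>+x'. F (x' - x) * ?I x' \<partial>lborel) = (\<integral>\<^sup>+z. F z * ?I (x + z) \<partial>lborel)" for x
      by (subst nn_integral_real_affine[where c = 1 and t = x]) auto
    then show ?thesis by simp
  qed
  also have "\<dots> = (\<integral>\<^sup>+x. \<integral>\<^sup>+z. ?c * ?c * (?I (x + z) * ?I x) * F z \<partial>lborel \<partial>lborel)"
    by (simp add: nn_integral_cmult[symmetric] nn_integral_multc[symmetric] mult_ac)
  also have "\<dots> = (\<integral>\<^sup>+z. \<integral>\<^sup>+x. ?c * ?c * (?I (x + z) * ?I x) * F z \<partial>lborel \<partial>lborel)"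
    by (rule lborel_pair.Fubini') measurable
  also have "\<dots> = (\<integral>\<^sup>+z. ennreal (tri z) * F z \<partial>lborel)"
    by (simp add: nn_integral_cmult nn_integral_multc overlap)
  finally show ?thesis .
qed

lemma nn_integral_tri: "(\<integral>\<^sup>+z. ennreal (tri z) \<partial>lborel) = 1"
  using nn_integral_unif_diff[of "\<lambda>_. 1"] prob_space.emeasure_space_1[OF prob_space_unif]
  by simp

section \<open>The displacement of a random child square\<close>

text \<open>This is \<open>(1 + a) / 2 - b\<close>, the distance between the two children of an interval before shifting.  In the
form \<open>g + 2 * a\<close> one sees that it exceeds every difference of two shifts by at least \<open>2 * a\<close>.\<close>

definition col_dist :: real where
  "col_dist = g + 2 * a"

text \<open>Passing from a square to one of its four children, chosen uniformly, moves the line by a random amount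
with this density, measured in units of the side of the parent.  The two diagonal children account for the summand \<open>2 * tri z\<close>.\<close>

definition step_dens :: "real \<Rightarrow> real" where
  "step_dens z = (2 * tri z + tri (z - col_dist) + tri (z + col_dist)) / 4"

lemma step_dens_nonneg: "0 \<le> step_dens z"
  by (simp add: step_dens_def tri_nonneg)

lemma step_dens_le: "step_dens z \<le> 1 / g"
  using tri_le[of z] tri_le[of "z - col_dist"] tri_le[of "z + col_dist"]
  by (simp add: step_dens_def)

lemma step_dens_eq_0: "1 - a \<le> \<bar>z\<bar> \<Longrightarrow> step_dens z = 0"
  using g_eq g_pos a_pos b_nonneg by (simp add: step_dens_def col_dist_def tri_eq_0)

lemma step_dens_lipschitz: "\<bar>step_dens x - step_dens y\<bar> \<le> \<bar>x - y\<bar> / g\<^sup>2"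
proof -
  define L where "L = \<bar>x - y\<bar> / g\<^sup>2"
  have "\<bar>tri x - tri y\<bar> \<le> L" "\<bar>tri (x - col_dist) - tri (y - col_dist)\<bar> \<le> L"
    "\<bar>tri (x + col_dist) - tri (y + col_dist)\<bar> \<le> L"
    using tri_lipschitz[of x y] tri_lipschitz[of "x - col_dist" "y - col_dist"]
      tri_lipschitz[of "x + col_dist" "y + col_dist"] by (simp_all add: L_def)
  then have "\<bar>step_dens x - step_dens y\<bar> \<le> L"
    unfolding step_dens_def abs_le_iff by (simp add: field_simps)
  then show ?thesis by (simp only: L_def)
qed

lemma measurable_step_dens [measurable]: "step_dens \<in> borel_measurable borel"
  unfolding step_dens_def by measurable

lemma nn_integral_step_dens: "(\<integral>\<^sup>+z. ennreal (step_dens z) \<partial>lborel) = 1"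
proof -
  have shift: "(\<integral>\<^sup>+z. ennreal (tri (z + c)) \<partial>lborel) = 1" for c
    using nn_integral_real_affine[of "\<lambda>z. ennreal (tri z)" 1 c] nn_integral_tri
    by (simp add: add.commute)
  have "ennreal (step_dens z) = ennreal (1/2) * ennreal (tri (z + 0))
      + ennreal (1/4) * ennreal (tri (z + (- col_dist))) + ennreal (1/4) * ennreal (tri (z + col_dist))" for z
  proof -
    have "step_dens z = 1/2 * tri (z + 0) + 1/4 * tri (z + (- col_dist)) + 1/4 * tri (z + col_dist)"
      by (simp add: step_dens_def)
    then show ?thesis
      by (simp only: ennreal_plus ennreal_mult tri_nonneg mult_nonneg_nonneg add_nonneg_nonneg
          zero_le_divide_1_iff zero_le_numeral)
  qed
  then have "(\<integral>\<^sup>+z. ennreal (step_dens z) \<partial>lborel) = ennreal (1/2) + ennreal (1/4) + ennreal (1/4)"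
    by (simp add: nn_integral_cmult nn_integral_add shift[of 0, simplified] shift[of col_dist]
        shift[of "- col_dist", simplified])
  also have "\<dots> = 1"
  proof -
    have "ennreal (1/2 + 1/4 + 1/4) = ennreal (1/2) + ennreal (1/4) + ennreal (1/4)"
      by (simp only: ennreal_plus zero_le_divide_1_iff zero_le_numeral add_nonneg_nonneg)
    then show ?thesis by simp
  qed
  finally show ?thesis .
qed

definition steps :: "real measure" where
  "steps = density lborel (\<lambda>z. ennreal (step_dens z))"

lemma sets_steps [measurable_cong, simp]: "sets steps = sets borel"
  by (simp add: steps_def)

lemma prob_space_steps: "prob_space steps"
  by standard (simp add: steps_def emeasure_density nn_integral_step_dens)

lemma AE_steps: "AE z in steps. \<bar>z\<bar> \<le> 1 - a"
proof -
  have "\<bar>z\<bar> \<le> 1 - a" if "0 < step_dens z" for z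
    using that step_dens_eq_0[of z] by (cases "1 - a \<le> \<bar>z\<bar>") auto
  then show ?thesis
    unfolding steps_def by (subst AE_density) auto
qed


section \<open>The eigenfunction of the offspring operator\<close>

text \<open>The sum of the rescaled displacements along a random branch of the tree of squares.  Its law is the expected
distribution of \<open>y - x\<close> when \<open>x\<close> and \<open>y\<close> are drawn from the natural measures on the two Cantor sets.\<close>

definition walk :: "(nat \<Rightarrow> real) \<Rightarrow> real" where
  "walk z = (\<Sum>k. a ^ k * z k)"

definition walk_law :: "real measure" where
  "walk_law = distr (\<Pi>\<^sub>M k\<in>UNIV. steps) borel walk"

lemma sets_walk_law [measurable_cong, simp]: "sets walk_law = sets borel"
  by (simp add: walk_law_def)

lemma measurable_walk [measurable]: "walk \<in> borel_measurable (\<Pi>\<^sub>M k\<in>UNIV. steps)"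
  unfolding walk_def by measurable

lemma prob_space_walk_law: "prob_space walk_law"
  unfolding walk_law_def
  by (intro prob_space.prob_space_distr prob_space_PiM prob_space_steps) measurable

lemma sums_geometric_bound: "(\<lambda>k. a ^ k * (1 - a)) sums 1"
  using sums_mult2[OF geometric_sums[of a], of "1 - a"] a_pos a_less_third by simp

lemma walk_summable:
  assumes "\<And>k. \<bar>z k\<bar> \<le> 1 - a"
  shows "summable (\<lambda>k. a ^ k * z k)"
proof (rule summable_comparison_test'[where N = 0])
  show "summable (\<lambda>k. a ^ k * (1 - a))"
    using sums_geometric_bound by (rule sums_summable)
  show "norm (a ^ k * z k) \<le> a ^ k * (1 - a)" for k
    using assms[of k] a_pos by (simp add: abs_mult mult_left_mono)
qed

lemma AE_steps_sequence: "AE z in (\<Pi>\<^sub>M k\<in>UNIV. steps). \<forall>k::nat. \<bar>z k\<bar> \<le> 1 - a"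
  by (intro AE_all_countable[THEN iffD2] allI AE_PiM_component prob_space_steps AE_steps) auto

lemma AE_walk_law: "AE y in walk_law. \<bar>y\<bar> \<le> 1"
  unfolding walk_law_def
proof (subst AE_distr_iff)
  show "AE z in (\<Pi>\<^sub>M k\<in>UNIV. steps). \<bar>walk z\<bar> \<le> 1"
    using AE_steps_sequence
  proof eventually_elim
    case (elim z)
    have "norm (\<Sum>k. a ^ k * z k) \<le> (\<Sum>k. a ^ k * (1 - a))"
      using elim a_pos
      by (intro norm_suminf_le sums_summable[OF sums_geometric_bound])
        (simp add: abs_mult mult_left_mono)
    then show ?case
      using sums_unique[OF sums_geometric_bound] by (simp add: walk_def)
  qed
qed auto

text \<open>Splitting off the first step expresses the self-similarity of the law.\<close>

lemma nn_integral_walk_law: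
  assumes [measurable]: "F \<in> borel_measurable borel"
  shows "(\<integral>\<^sup>+y. F y \<partial>walk_law) = (\<integral>\<^sup>+s. \<integral>\<^sup>+y. F (s + a * y) \<partial>walk_law \<partial>steps)"
proof -
  interpret steps: prob_space steps by (rule prob_space_steps)
  interpret seq: sequence_space steps ..
  let ?S = "\<Pi>\<^sub>M k\<in>UNIV. steps"
  interpret S: prob_space ?S by (intro prob_space_PiM prob_space_steps)
  have walk_cons: "walk (case_nat s z) = s + a * walk z" if "\<forall>k. \<bar>z k\<bar> \<le> 1 - a" for s z
  proof -
    have s: "summable (\<lambda>k. a ^ k * z k)"
      using that by (intro walk_summable) auto
    have "(\<lambda>k. a ^ Suc k * case_nat s z (Suc k)) sums (a * walk z)"
      using sums_mult[OF summable_sums[OF s], of a] by (simp add: walk_def mult.assoc)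
    then have "(\<lambda>k. a ^ k * case_nat s z k) sums (a * walk z + a ^ 0 * case_nat s z 0)"
      by (rule sums_Suc)
    then show ?thesis
      by (simp add: walk_def[of "case_nat s z"] sums_iff)
  qed
  have "(\<integral>\<^sup>+y. F y \<partial>walk_law) = (\<integral>\<^sup>+z. F (walk z) \<partial>?S)"
    unfolding walk_law_def by (subst nn_integral_distr) auto
  also have "\<dots> = (\<integral>\<^sup>+p. F (walk (case_nat (fst p) (snd p))) \<partial>(steps \<Otimes>\<^sub>M ?S))"
    by (subst seq.PiM_iter[symmetric], subst nn_integral_distr)
      (auto simp: case_prod_unfold)
  also have "\<dots> = (\<integral>\<^sup>+s. \<integral>\<^sup>+z. F (walk (case_nat s z)) \<partial>?S \<partial>steps)"
    by (subst S.nn_integral_fst[symmetric]) auto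
  also have "\<dots> = (\<integral>\<^sup>+s. \<integral>\<^sup>+z. F (s + a * walk z) \<partial>?S \<partial>steps)"
    using AE_steps_sequence
    by (intro nn_integral_cong nn_integral_cong_AE) (auto elim!: eventually_mono simp: walk_cons)
  also have "\<dots> = (\<integral>\<^sup>+s. \<integral>\<^sup>+y. F (s + a * y) \<partial>walk_law \<partial>steps)"
    unfolding walk_law_def by (intro nn_integral_cong, subst nn_integral_distr) auto
  finally show ?thesis .
qed

text \<open>The density of \<open>walk_law\<close>: given all steps but the first, the walk has the density \<open>step_dens\<close>, translated.
This form makes \<open>h\<close> inherit the Lipschitz bound of \<open>step_dens\<close>.\<close>

definition h :: "real \<Rightarrow> real" where
  "h x = (\<integral>y. step_dens (x - a * y) \<partial>walk_law)"

lemma integrable_step_dens_walk: "integrable walk_law (\<lambda>y. step_dens (x - a * y))"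
proof -
  interpret prob_space walk_law by (rule prob_space_walk_law)
  show ?thesis
    using step_dens_le step_dens_nonneg by (intro integrable_const_bound[of _ "1 / g"]) auto
qed

lemma h_nonneg: "0 \<le> h x"
  unfolding h_def by (intro integral_nonneg_AE) (simp add: step_dens_nonneg)

lemma ennreal_h: "ennreal (h x) = (\<integral>\<^sup>+y. ennreal (step_dens (x - a * y)) \<partial>walk_law)"
  unfolding h_def
  by (intro nn_integral_eq_integral[symmetric] integrable_step_dens_walk) (simp add: step_dens_nonneg)

lemma h_le: "h x \<le> 1 / g"
proof -
  interpret prob_space walk_law by (rule prob_space_walk_law)
  show ?thesis
    unfolding h_def by (intro integral_le_const integrable_step_dens_walk) (simp add: step_dens_le)
qed

lemma h_lipschitz: "\<bar>h x - h y\<bar> \<le> \<bar>x - y\<bar> / g\<^sup>2"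
proof -
  interpret prob_space walk_law by (rule prob_space_walk_law)
  let ?d = "\<lambda>w. step_dens (x - a * w) - step_dens (y - a * w)"
  have int: "integrable walk_law ?d"
    by (intro Bochner_Integration.integrable_diff integrable_step_dens_walk)
  have eq: "h x - h y = (\<integral>w. ?d w \<partial>walk_law)"
    unfolding h_def by (intro Bochner_Integration.integral_diff[symmetric] integrable_step_dens_walk)
  have "\<bar>\<integral>w. ?d w \<partial>walk_law\<bar> \<le> (\<integral>w. \<bar>?d w\<bar> \<partial>walk_law)"
    by (rule integral_abs_bound)
  moreover have "(\<integral>w. \<bar>?d w\<bar> \<partial>walk_law) \<le> \<bar>x - y\<bar> / g\<^sup>2"
  proof (intro integral_le_const integrable_abs int always_eventually allI)
    fix w
    have shift: "x - a * w - (y - a * w) = x - y" by simp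
    show "\<bar>?d w\<bar> \<le> \<bar>x - y\<bar> / g\<^sup>2"
      by (rule step_dens_lipschitz[of "x - a * w" "y - a * w", unfolded shift])
  qed
  ultimately show ?thesis
    unfolding eq by (rule order_trans)
qed

text \<open>All steps are at most \<open>1 - a\<close> in absolute value, so the walk stays in \<open>{-1..1}\<close>: a square whose interior
misses the line gets weight zero.\<close>

lemma h_eq_0:
  assumes "1 \<le> \<bar>x\<bar>"
  shows "h x = 0"
proof -
  have "AE y in walk_law. ennreal (step_dens (x - a * y)) = 0"
    using AE_walk_law
  proof eventually_elim
    case (elim y)
    have "\<bar>a * y\<bar> \<le> a"
      using elim a_pos by (simp add: abs_mult)
    then have "1 - a \<le> \<bar>x - a * y\<bar>"
      using assms by linarith
    then show ?case
      by (simp add: step_dens_eq_0)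
  qed
  then have "ennreal (h x) = 0"
    unfolding ennreal_h by (subst nn_integral_0_iff_AE) auto
  then show ?thesis
    using h_nonneg[of x] by (simp add: ennreal_eq_0_iff)
qed

lemma continuous_h: "continuous_on UNIV h"
proof -
  have "(1 / g\<^sup>2)-lipschitz_on UNIV h"
    using h_lipschitz g_pos by (intro lipschitz_onI) (auto simp: dist_real_def)
  then show ?thesis by (rule lipschitz_on_continuous_on)
qed

lemma measurable_h [measurable]: "h \<in> borel_measurable borel"
  using continuous_h by (rule borel_measurable_continuous_onI)

lemma walk_law_eq_density: "walk_law = density lborel (\<lambda>x. ennreal (h x))"
proof (rule measure_eqI)
  interpret W: prob_space walk_law by (rule prob_space_walk_law)
  interpret steps: prob_space steps by (rule prob_space_steps)
  interpret ps: pair_sigma_finite walk_law lborel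
    by (intro pair_sigma_finite.intro W.sigma_finite_measure_axioms lborel.sigma_finite_measure_axioms)
  interpret ps2: pair_sigma_finite steps walk_law
    by (intro pair_sigma_finite.intro W.sigma_finite_measure_axioms steps.sigma_finite_measure_axioms)
  fix A assume "A \<in> sets walk_law"
  then have [measurable]: "A \<in> sets borel" by simp
  have "emeasure walk_law A = (\<integral>\<^sup>+y. indicator A y \<partial>walk_law)"
    by simp
  also have "\<dots> = (\<integral>\<^sup>+s. \<integral>\<^sup>+y. indicator A (s + a * y) \<partial>walk_law \<partial>steps)"
    by (rule nn_integral_walk_law) measurable
  also have "\<dots> = (\<integral>\<^sup>+y. \<integral>\<^sup>+s. indicator A (s + a * y) \<partial>steps \<partial>walk_law)"
    by (rule ps2.Fubini'[symmetric]) measurable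
  also have "\<dots> = (\<integral>\<^sup>+y. \<integral>\<^sup>+s. ennreal (step_dens s) * indicator A (s + a * y) \<partial>lborel \<partial>walk_law)"
    unfolding steps_def by (intro nn_integral_cong, subst nn_integral_density) auto
  also have "\<dots> = (\<integral>\<^sup>+y. \<integral>\<^sup>+x. ennreal (step_dens (x - a * y)) * indicator A x \<partial>lborel \<partial>walk_law)"
  proof (rule nn_integral_cong)
    fix y
    show "(\<integral>\<^sup>+s. ennreal (step_dens s) * indicator A (s + a * y) \<partial>lborel)
        = (\<integral>\<^sup>+x. ennreal (step_dens (x - a * y)) * indicator A x \<partial>lborel)"
      by (subst nn_integral_real_affine[where c = 1 and t = "- (a * y)"]) auto
  qed
  also have "\<dots> = (\<integral>\<^sup>+x. \<integral>\<^sup>+y. ennreal (step_dens (x - a * y)) * indicator A x \<partial>walk_law \<partial>lborel)"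
    by (rule ps.Fubini'[symmetric]) measurable
  also have "\<dots> = (\<integral>\<^sup>+x. ennreal (h x) * indicator A x \<partial>lborel)"
    by (simp add: nn_integral_multc ennreal_h)
  also have "\<dots> = emeasure (density lborel (\<lambda>x. ennreal (h x))) A"
    by (simp add: emeasure_density)
  finally show "emeasure walk_law A = emeasure (density lborel (\<lambda>x. ennreal (h x))) A" .
qed simp

lemma nn_integral_h: "(\<integral>\<^sup>+x. ennreal (h x) \<partial>lborel) = 1"
  using prob_space.emeasure_space_1[OF prob_space_walk_law]
  by (simp add: walk_law_eq_density emeasure_density)

text \<open>Since \<open>h\<close> is itself the density of \<open>walk_law\<close>, its defining integral becomes an eigenfunction equation.\<close>

lemma h_fixed_point: "ennreal (h x) = (\<integral>\<^sup>+y. ennreal (step_dens (x - a * y) * h y) \<partial>lborel)"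
proof -
  have "ennreal (h x) = (\<integral>\<^sup>+y. ennreal (step_dens (x - a * y)) \<partial>density lborel (\<lambda>x. ennreal (h x)))"
    using ennreal_h[of x] walk_law_eq_density by simp
  also have "\<dots> = (\<integral>\<^sup>+y. ennreal (step_dens (x - a * y) * h y) \<partial>lborel)"
    by (subst nn_integral_density)
      (auto intro!: nn_integral_cong simp: ennreal_mult step_dens_nonneg h_nonneg mult.commute)
  finally show ?thesis .
qed

section \<open>Words and left endpoints\<close>

abbreviation shifts :: "(nat list \<Rightarrow> real) measure" where
  "shifts \<equiv> larsson_shifts a b"

abbreviation left :: "(nat list \<Rightarrow> real) \<Rightarrow> nat list \<Rightarrow> real" where
  "left \<equiv> larsson_left a b"

definition words_of :: "nat \<Rightarrow> nat list set" where
  "words_of n = {w \<in> words. length w = n}"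

lemma finite_words_of [simp]: "finite (words_of n)"
  using finite_words by (simp add: words_of_def)

lemma words_of_0: "words_of 0 = {[]}"
  by (auto simp: words_of_def words_def)

lemma append_in_words: "w @ [i] \<in> words \<longleftrightarrow> w \<in> words \<and> (i = 1 \<or> i = 2)"
  by (auto simp: words_def)

lemma Cons_in_words: "i # w \<in> words \<longleftrightarrow> w \<in> words \<and> (i = 1 \<or> i = 2)"
  by (auto simp: words_def)

text \<open>Words are stored with the last letter first, so appending a letter to the list prepends it to the word
and selects a subtree of the root.\<close>

lemma words_of_Suc: "words_of (Suc n) = (\<lambda>w. w @ [1]) ` words_of n \<union> (\<lambda>w. w @ [2]) ` words_of n"
proof (intro equalityI subsetI)
  fix w assume "w \<in> words_of (Suc n)"
  then obtain v i where "w = v @ [i]" "v @ [i] \<in> words" "length v = n"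
    by (cases w rule: rev_cases) (auto simp: words_of_def)
  then show "w \<in> (\<lambda>w. w @ [1]) ` words_of n \<union> (\<lambda>w. w @ [2]) ` words_of n"
    by (auto simp: words_of_def append_in_words)
qed (auto simp: words_of_def append_in_words)

lemma sum_words_of_Suc:
  "(\<Sum>w\<in>words_of (Suc n). f w) = (\<Sum>i\<in>{1, 2}. \<Sum>w\<in>words_of n. f (w @ [i]))"
  unfolding words_of_Suc
  by (subst sum.union_disjoint) (auto simp: sum.reindex inj_on_def)

lemma card_words_of: "card (words_of n) = 2 ^ n"
proof (induction n)
  case (Suc n)
  have "card (words_of (Suc n)) = (\<Sum>w\<in>words_of (Suc n). 1)"
    by simp
  then show ?case
    using Suc unfolding sum_words_of_Suc by simp
qed (simp add: words_of_0)

text \<open>The product space contains all real families; the geometric statements need the shifts to lie in the interval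
on which their law lives.\<close>

definition admissible :: "(nat list \<Rightarrow> real) \<Rightarrow> bool" where
  "admissible u \<longleftrightarrow> (\<forall>w\<in>words - {[]}. 0 \<le> u w \<and> u w \<le> g)"

lemma shifts_eq: "shifts = (\<Pi>\<^sub>M w\<in>words - {[]}. unif)"
  by (simp add: larsson_shifts_def unif_def)

lemma prob_space_shifts: "prob_space shifts"
  unfolding shifts_eq by (intro prob_space_PiM prob_space_unif)

lemma AE_admissible: "AE u in shifts. admissible u"
  unfolding admissible_def shifts_eq
proof (intro AE_ball_countable[THEN iffD2] ballI AE_PiM_component prob_space_unif AE_unif)
  show "countable (words - {[]})"
    by (intro countable_Diff) (simp add: words_def)
qed

definition offset :: "nat \<Rightarrow> real" where
  "offset i = (if i = 1 then b else (1 + a) / 2)"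

lemma left_Cons: "left u (i # w) = left u w + a ^ length w * (offset i + u (i # w))"
  by (simp add: offset_def)

text \<open>The upper bound says that a shifted child stays inside its parent; for the second child the bound
is \<open>(1 + a) / 2 + g = 1 - a - b\<close>.\<close>

lemma offset_shift_bounds:
  assumes "0 \<le> x" "x \<le> g" "i = 1 \<or> i = 2"
  shows "0 \<le> offset i + x" "offset i + x \<le> 1 - a"
  using assms g_eq a_pos a_less_third b_nonneg by (auto simp: offset_def field_simps)

lemma left_child_bounds:
  assumes "admissible u" "i # w \<in> words"
  shows "left u w \<le> left u (i # w)"
    and "left u (i # w) + a ^ length (i # w) \<le> left u w + a ^ length w"
proof -
  have x: "0 \<le> u (i # w)" "u (i # w) \<le> g" and i: "i = 1 \<or> i = 2"
    using assms by (auto simp: admissible_def Cons_in_words)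
  have p: "0 \<le> a ^ length w"
    using a_pos by simp
  show "left u w \<le> left u (i # w)"
    using offset_shift_bounds(1)[OF x i] p unfolding left_Cons by simp
  have "a ^ length w * (offset i + u (i # w)) \<le> a ^ length w * (1 - a)"
    using offset_shift_bounds(2)[OF x i] p by (rule mult_left_mono)
  then show "left u (i # w) + a ^ length (i # w) \<le> left u w + a ^ length w"
    unfolding left_Cons by (simp add: algebra_simps)
qed

lemma left_bounds:
  assumes "admissible u" "w \<in> words"
  shows "0 \<le> left u w \<and> left u w \<le> 1 - a ^ length w"
  using assms(2)
proof (induction w)
  case (Cons i w)
  then show ?case
    using left_child_bounds[OF assms(1) Cons.prems] by (auto simp: Cons_in_words)
qed simp

section \<open>The martingale density\<close>

abbreviation growth :: real where "growth \<equiv> 4 * a"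

text \<open>The sum over all squares of level \<open>n\<close>; only those crossed by the line at height \<open>t\<close> contribute.  It is the
conditional expectation, given the first \<open>n\<close> levels, of the density at \<open>t\<close> of the difference of the natural
measures.\<close>

definition dens :: "nat \<Rightarrow> (nat list \<Rightarrow> real) \<Rightarrow> (nat list \<Rightarrow> real) \<Rightarrow> real \<Rightarrow> real" where
  "dens n u u' t =
     (\<Sum>v\<in>words_of n. \<Sum>w\<in>words_of n. h ((t - left u' w + left u v) / a ^ n)) / growth ^ n"

lemma growth_power_dens:
  "growth ^ n * dens n u u' t =
     (\<Sum>v\<in>words_of n. \<Sum>w\<in>words_of n. h ((t - left u' w + left u v) / a ^ n))"
  using a_pos by (simp add: dens_def)

lemma dens_nonneg: "0 \<le> dens n u u' t"
  using a_pos by (auto simp: dens_def intro!: sum_nonneg divide_nonneg_nonneg h_nonneg)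

lemma dens_0: "dens 0 u u' t = h t"
  by (simp add: dens_def words_of_0)

lemma dens_posD:
  assumes "0 < dens n u u' t"
  obtains v w where "v \<in> words_of n" "w \<in> words_of n" "\<bar>t - left u' w + left u v\<bar> < a ^ n"
proof -
  have "\<exists>v\<in>words_of n. \<exists>w\<in>words_of n. h ((t - left u' w + left u v) / a ^ n) \<noteq> 0"
  proof (rule ccontr)
    assume "\<not> ?thesis"
    then have "dens n u u' t = 0"
      by (simp add: dens_def)
    with assms show False by simp
  qed
  then obtain v w where vw: "v \<in> words_of n" "w \<in> words_of n"
    and "h ((t - left u' w + left u v) / a ^ n) \<noteq> 0" by blast
  then have "\<bar>(t - left u' w + left u v) / a ^ n\<bar> < 1"
    using h_eq_0 not_le by blast
  then have "\<bar>t - left u' w + left u v\<bar> < a ^ n"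
    using a_pos by (simp add: abs_divide)
  with vw show ?thesis by (rule that)
qed

text \<open>Both Cantor sets lie in the unit interval, so a line with \<open>\<bar>t\<bar> \<ge> 1\<close> crosses no square.\<close>

lemma dens_eq_0:
  assumes "admissible u" "admissible u'" "1 \<le> \<bar>t\<bar>"
  shows "dens n u u' t = 0"
proof (rule ccontr)
  assume "dens n u u' t \<noteq> 0"
  then have "0 < dens n u u' t"
    using dens_nonneg[of n u u' t] by linarith
  then obtain v w where vw: "v \<in> words_of n" "w \<in> words_of n"
    and t: "\<bar>t - left u' w + left u v\<bar> < a ^ n"
    by (rule dens_posD)
  have "0 \<le> left u v" "left u v \<le> 1 - a ^ n" "0 \<le> left u' w" "left u' w \<le> 1 - a ^ n"
    using vw left_bounds[OF assms(1), of v] left_bounds[OF assms(2), of w]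
    by (auto simp: words_of_def)
  with t assms(3) show False by linarith
qed

lemma measurable_left [measurable]:
  "w \<in> words \<Longrightarrow> (\<lambda>u. left u w) \<in> borel_measurable shifts"
  by (rule measurable_larsson_left)

lemma measurable_dens [measurable]:
  "(\<lambda>p. dens n (fst p) (snd p) t) \<in> borel_measurable (shifts \<Otimes>\<^sub>M shifts)"
  unfolding dens_def
proof (intro borel_measurable_divide borel_measurable_sum borel_measurable_const)
  fix v w assume "v \<in> words_of n" "w \<in> words_of n"
  then have [measurable]: "v \<in> words" "w \<in> words"
    by (auto simp: words_of_def)
  show "(\<lambda>p. h ((t - left (snd p) w + left (fst p) v) / a ^ n)) \<in> borel_measurable (shifts \<Otimes>\<^sub>M shifts)"
    by measurable
qed

section \<open>Decomposition at the root\<close>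

definition nth_child :: "nat \<Rightarrow> 'c \<times> 'c \<Rightarrow> 'c" where
  "nth_child i p = (if i = 1 then fst p else snd p)"

lemma nth_child_simps [simp]: "nth_child 1 p = fst p" "nth_child (Suc 0) p = fst p" "nth_child 2 p = snd p"
  by (simp_all add: nth_child_def)

text \<open>Assembles a family of shifts from the two shifts \<open>x\<close> of the first generation and the families \<open>y\<close>
belonging to the two subtrees.\<close>

definition graft :: "real \<times> real \<Rightarrow> (nat list \<Rightarrow> real) \<times> (nat list \<Rightarrow> real) \<Rightarrow> nat list \<Rightarrow> real" where
  "graft x y = (\<lambda>w\<in>words - {[]}.
     if butlast w = [] then nth_child (last w) x else nth_child (last w) y (butlast w))"

lemma graft_root: "i = 1 \<or> i = 2 \<Longrightarrow> graft x y [i] = nth_child i x"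
  by (auto simp: graft_def words_def)

lemma graft_child:
  "w \<in> words - {[]} \<Longrightarrow> i = 1 \<or> i = 2 \<Longrightarrow> graft x y (w @ [i]) = nth_child i y w"
  by (auto simp: graft_def append_in_words)

lemma left_graft:
  assumes "w \<in> words" "i = 1 \<or> i = 2"
  shows "left (graft x y) (w @ [i]) = offset i + nth_child i x + a * left (nth_child i y) w"
  using assms(1)
proof (induction w)
  case Nil
  show ?case
    using assms(2) by (simp add: left_Cons graft_root del: larsson_left.simps(2))
next
  case (Cons j w)
  have "left (graft x y) ((j # w) @ [i])
      = left (graft x y) (w @ [i]) + a ^ Suc (length w) * (offset j + graft x y ((j # w) @ [i]))"
    by (simp add: left_Cons del: larsson_left.simps(2))
  also have "graft x y ((j # w) @ [i]) = nth_child i y (j # w)"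
    by (rule graft_child) (use Cons.prems assms(2) in auto)
  also have "left (graft x y) (w @ [i]) = offset i + nth_child i x + a * left (nth_child i y) w"
    using Cons by (simp add: Cons_in_words)
  finally show ?case
    by (simp add: left_Cons algebra_simps del: larsson_left.simps(2))
qed

text \<open>The normalised position, relative to the child square in column \<open>i\<close> and row \<open>j\<close>, of a line with position
\<open>t\<close> relative to the parent.\<close>

definition child_pos :: "real \<times> real \<Rightarrow> real \<times> real \<Rightarrow> real \<Rightarrow> nat \<Rightarrow> nat \<Rightarrow> real" where
  "child_pos x x' t i j = (t - (offset j + nth_child j x') + (offset i + nth_child i x)) / a"

text \<open>The squares of level \<open>n + 1\<close> are grouped by their ancestor in the first generation.  Inside that ancestor they
are a rescaled copy of the squares of level \<open>n\<close>.\<close>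

lemma dens_graft:
  "dens (Suc n) (graft x y) (graft x' y') t =
     (\<Sum>i\<in>{1, 2}. \<Sum>j\<in>{1, 2}. dens n (nth_child i y) (nth_child j y') (child_pos x x' t i j)) / growth"
proof -
  let ?h = "\<lambda>i j v w. h ((child_pos x x' t i j - left (nth_child j y') w + left (nth_child i y) v) / a ^ n)"
  have h_eq: "h ((t - left (graft x' y') (w @ [j]) + left (graft x y) (v @ [i])) / a ^ Suc n) = ?h i j v w"
    if "v \<in> words_of n" "w \<in> words_of n" "i \<in> {1, 2}" "j \<in> {1, 2}" for i j v w
  proof -
    have "left (graft x' y') (w @ [j]) = offset j + nth_child j x' + a * left (nth_child j y') w"
      "left (graft x y) (v @ [i]) = offset i + nth_child i x + a * left (nth_child i y) v"
      using that by (auto intro!: left_graft simp: words_of_def)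
    then have "t - left (graft x' y') (w @ [j]) + left (graft x y) (v @ [i])
        = a * (child_pos x x' t i j - left (nth_child j y') w + left (nth_child i y) v)"
      using a_pos by (simp add: child_pos_def field_simps)
    then show ?thesis
      using a_pos by simp
  qed
  have "growth ^ Suc n * dens (Suc n) (graft x y) (graft x' y') t
      = (\<Sum>v\<in>words_of (Suc n). \<Sum>w\<in>words_of (Suc n).
          h ((t - left (graft x' y') w + left (graft x y) v) / a ^ Suc n))"
    by (rule growth_power_dens)
  also have "\<dots> = (\<Sum>i\<in>{1, 2}. \<Sum>v\<in>words_of n. \<Sum>j\<in>{1, 2}. \<Sum>w\<in>words_of n. ?h i j v w)"
    unfolding sum_words_of_Suc by (intro sum.cong refl h_eq)
  also have "\<dots> = (\<Sum>i\<in>{1, 2}. \<Sum>j\<in>{1, 2}. \<Sum>v\<in>words_of n. \<Sum>w\<in>words_of n. ?h i j v w)"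
    by (intro sum.cong refl sum.swap)
  also have "\<dots> = growth ^ n *
      (\<Sum>i\<in>{1, 2}. \<Sum>j\<in>{1, 2}. dens n (nth_child i y) (nth_child j y') (child_pos x x' t i j))"
    unfolding growth_power_dens[symmetric] by (simp only: sum_distrib_left)
  finally have "growth ^ n * (growth * dens (Suc n) (graft x y) (graft x' y') t) = growth ^ n *
      (\<Sum>i\<in>{1, 2}. \<Sum>j\<in>{1, 2}. dens n (nth_child i y) (nth_child j y') (child_pos x x' t i j))"
    by (simp only: power_Suc mult_ac)
  moreover have ne: "growth ^ n \<noteq> 0" "growth \<noteq> 0"
    using a_pos by auto
  ultimately have "dens (Suc n) (graft x y) (graft x' y') t * growth =
      (\<Sum>i\<in>{1, 2}. \<Sum>j\<in>{1, 2}. dens n (nth_child i y) (nth_child j y') (child_pos x x' t i j))"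
    unfolding mult_left_cancel[OF ne(1)] by (subst mult.commute)
  then show ?thesis
    by (rule eq_divide_imp[OF ne(2)])
qed

abbreviation root_law :: "(real \<times> real) measure" where
  "root_law \<equiv> unif \<Otimes>\<^sub>M unif"

abbreviation shifts2 :: "((nat list \<Rightarrow> real) \<times> (nat list \<Rightarrow> real)) measure" where
  "shifts2 \<equiv> shifts \<Otimes>\<^sub>M shifts"

lemma sets_root_law [measurable_cong]: "sets root_law = sets (borel \<Otimes>\<^sub>M borel)"
  by (rule sets_pair_measure_cong) simp_all

lemma measurable_component:
  assumes "w \<in> words - {[]}" and [measurable]: "f \<in> N \<rightarrow>\<^sub>M shifts"
  shows "(\<lambda>x. f x w) \<in> borel_measurable N"
proof -
  have "(\<lambda>u. u w) \<in> shifts \<rightarrow>\<^sub>M unif"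
    unfolding shifts_eq using assms(1) by (rule measurable_component_singleton)
  then have [measurable]: "(\<lambda>u. u w) \<in> borel_measurable shifts"
    by (simp cong: measurable_cong_sets)
  show ?thesis by measurable
qed

lemma measurable_graft [measurable]:
  "(\<lambda>p. graft (fst p) (snd p)) \<in> root_law \<Otimes>\<^sub>M shifts2 \<rightarrow>\<^sub>M shifts"
  unfolding shifts_eq[of] graft_def
proof (rule measurable_restrict)
  fix w assume w: "w \<in> words - {[]}"
  then obtain v i where vi: "w = v @ [i]" "v \<in> words" "i = 1 \<or> i = 2"
    by (cases w rule: rev_cases) (auto simp: append_in_words)
  have "(\<lambda>p. if v = [] then nth_child i (fst p) else nth_child i (snd p) v)
      \<in> borel_measurable (root_law \<Otimes>\<^sub>M shifts2)"
  proof (cases "v = []")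
    case True
    then show ?thesis by (simp add: nth_child_def)
  next
    case False
    then have [measurable]: "v \<in> words - {[]}" using vi by simp
    note [measurable (raw)] = measurable_component
    show ?thesis using False by (simp add: nth_child_def)
  qed
  then show "(\<lambda>p. if butlast w = [] then nth_child (last w) (fst p)
        else nth_child (last w) (snd p) (butlast w)) \<in> root_law \<Otimes>\<^sub>M (Pi\<^sub>M (words - {[]}) (\<lambda>w. unif) \<Otimes>\<^sub>M Pi\<^sub>M (words - {[]}) (\<lambda>w. unif)) \<rightarrow>\<^sub>M unif"
    unfolding vi(1) butlast_snoc last_snoc by (simp add: shifts_eq cong: measurable_cong_sets)
qed

text \<open>Both sides are compared on cylinder sets: every nonempty word is either a single letter or a nonempty word
followed, as a list, by a letter, so a finite product over words splits into four products.\<close>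

lemma distr_graft:
  "distr (root_law \<Otimes>\<^sub>M shifts2) shifts (\<lambda>p. graft (fst p) (snd p)) = shifts"
proof -
  let ?P = "root_law \<Otimes>\<^sub>M shifts2" and ?f = "\<lambda>p. graft (fst p) (snd p)"
  let ?I = "words - {[]}"
  interpret U: prob_space unif by (rule prob_space_unif)
  interpret S: prob_space shifts by (rule prob_space_shifts)
  interpret SS: pair_prob_space shifts shifts ..
  interpret UU: pair_prob_space unif unif ..
  interpret P: pair_prob_space root_law shifts2 ..
  interpret prod: product_prob_space "\<lambda>_. unif" ?I ..
  have "distr ?P shifts ?f = PiM ?I (\<lambda>_. unif)"
  proof (rule measure_eqI_PiM_infinite)
    show "finite_measure (distr ?P shifts ?f)"
      by (intro prob_space.finite_measure P.P.prob_space_distr measurable_graft)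
    fix A and J :: "nat list set"
    assume J: "finite J" "J \<subseteq> ?I" and A: "\<And>w. w \<in> J \<Longrightarrow> A w \<in> sets unif"
    define R where "R i = {x. [i] \<in> J \<longrightarrow> x \<in> A [i]}" for i
    define K where "K i = {w \<in> ?I. w @ [i] \<in> J}" for i
    define B where "B i = {y \<in> space shifts. \<forall>w\<in>K i. y w \<in> A (w @ [i])}" for i
    have fin: "finite (K i)" for i
    proof -
      have "finite ((\<lambda>w. w @ [i]) -` J)"
        using J(1) by (rule finite_vimageI) (simp add: inj_def)
      then show ?thesis
        by (rule finite_subset[rotated]) (auto simp: K_def)
    qed
    have R: "emeasure unif (R i) = (\<Prod>w\<in>J \<inter> {[i]}. emeasure unif (A w))" "R i \<in> sets unif" for i
      using A[of "[i]"] U.emeasure_space_1 by (cases "[i] \<in> J"; simp add: R_def)+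
    have B_sets: "B i \<in> sets shifts" for i
      unfolding B_def shifts_eq using A
      by (intro sets.sets_Collect_finite_All fin sets_Collect_single') (auto simp: K_def)
    have B: "emeasure shifts (B i) = (\<Prod>w\<in>(\<lambda>w. w @ [i]) ` K i. emeasure unif (A w))" for i
    proof -
      have "emeasure shifts (B i) = (\<Prod>w\<in>K i. emeasure unif (A (w @ [i])))"
        unfolding B_def shifts_eq using fin A
        by (intro prod.emeasure_PiM_Collect) (auto simp: K_def)
      then show ?thesis
        by (simp add: prod.reindex inj_on_def)
    qed
    \<comment> \<open>In order: the two letters, and the words in the two subtrees.\<close>
    have J_eq: "J = ((J \<inter> {[1]}) \<union> (J \<inter> {[2]})) \<union> ((\<lambda>w. w @ [1]) ` K 1 \<union> (\<lambda>w. w @ [2]) ` K 2)"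
      (is "_ = ?J")
    proof (intro equalityI subsetI)
      fix w assume "w \<in> J"
      moreover from this J(2) obtain v i where "w = v @ [i]" "v \<in> words" "i = 1 \<or> i = 2"
        by (cases w rule: rev_cases) (auto simp: append_in_words subset_eq)
      ultimately show "w \<in> ?J"
        by (cases "v = []") (auto simp: K_def)
    qed (auto simp: K_def)
    have preimage: "?f -` prod_emb ?I (\<lambda>_. unif) J (Pi\<^sub>E J A) \<inter> space ?P = (R 1 \<times> R 2) \<times> (B 1 \<times> B 2)"
    proof (intro set_eqI)
      fix p :: "(real \<times> real) \<times> (nat list \<Rightarrow> real) \<times> (nat list \<Rightarrow> real)"
      obtain x :: "real \<times> real" and y :: "(nat list \<Rightarrow> real) \<times> (nat list \<Rightarrow> real)"
        where p: "p = (x, y)" by (cases p)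
      have "graft x y \<in> space (PiM ?I (\<lambda>_. unif))"
        by (simp add: space_PiM graft_def)
      then have "p \<in> ?f -` prod_emb ?I (\<lambda>_. unif) J (Pi\<^sub>E J A) \<inter> space ?P \<longleftrightarrow>
          fst y \<in> space shifts \<and> snd y \<in> space shifts \<and> (\<forall>w\<in>J. graft x y w \<in> A w)"
        using J(2) by (auto simp: p prod_emb_def space_pair_measure space_PiM Pi_iff PiE_def mem_Times_iff)
      also have "(\<forall>w\<in>J. graft x y w \<in> A w) \<longleftrightarrow>
          (\<forall>i\<in>{1,2}. ([i] \<in> J \<longrightarrow> nth_child i x \<in> A [i]) \<and> (\<forall>w\<in>K i. nth_child i y w \<in> A (w @ [i])))"
        (is "?l \<longleftrightarrow> ?r")
      proof
        assume ?l
        show ?r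
        proof (intro ballI conjI impI)
          fix i :: nat assume i: "i \<in> {1,2}"
          then have i': "i = 1 \<or> i = 2" by simp
          show "nth_child i x \<in> A [i]" if "[i] \<in> J"
            using \<open>?l\<close> that graft_root[OF i', of x y] by metis
          show "nth_child i y w \<in> A (w @ [i])" if "w \<in> K i" for w
            using \<open>?l\<close> that graft_child[OF _ i', of w x y] unfolding K_def by auto
        qed
      next
        assume ?r
        show ?l
        proof
          fix w assume w: "w \<in> J"
          with J(2) obtain v i where v: "w = v @ [i]" "v \<in> words" and i: "i = 1 \<or> i = 2"
            by (cases w rule: rev_cases) (auto simp: append_in_words subset_eq)
          show "graft x y w \<in> A w"
          proof (cases "v = []")
            case True
            then show ?thesis
              using \<open>?r\<close> w v i graft_root[OF i, of x y] by auto
          next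
            case False
            then show ?thesis
              using \<open>?r\<close> w v i graft_child[OF _ i, of v x y] by (auto simp: K_def)
          qed
        qed
      qed
      finally show "p \<in> ?f -` prod_emb ?I (\<lambda>_. unif) J (Pi\<^sub>E J A) \<inter> space ?P \<longleftrightarrow>
          p \<in> (R 1 \<times> R 2) \<times> (B 1 \<times> B 2)"
        by (cases x; cases y) (auto simp: p R_def B_def)
    qed
    have "emeasure (distr ?P shifts ?f) (prod_emb ?I (\<lambda>_. unif) J (Pi\<^sub>E J A))
        = emeasure ?P ((R 1 \<times> R 2) \<times> (B 1 \<times> B 2))"
      unfolding preimage[symmetric]
      by (rule emeasure_distr[OF measurable_graft]) (use J A in \<open>auto simp: shifts_eq\<close>)
    also have "\<dots> = (emeasure unif (R 1) * emeasure unif (R 2)) * (emeasure shifts (B 1) * emeasure shifts (B 2))"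
      using R(2) B_sets
      by (simp add: SS.P.emeasure_pair_measure_Times
          S.emeasure_pair_measure_Times U.emeasure_pair_measure_Times)
    also have "\<dots> = (\<Prod>w\<in>?J. emeasure unif (A w))"
    proof -
      have "((J \<inter> {[1]}) \<union> (J \<inter> {[2]})) \<inter> ((\<lambda>w. w @ [1]) ` K 1 \<union> (\<lambda>w. w @ [2]) ` K 2) = {}"
        "(J \<inter> {[1]}) \<inter> (J \<inter> {[2 :: nat]}) = {}"
        "(\<lambda>w. w @ [1]) ` K 1 \<inter> (\<lambda>w. w @ [2]) ` K 2 = {}"
        by (auto simp: K_def)
      note disj = this
      have "finite (J \<inter> {[1]})" "finite (J \<inter> {[2]})"
        "finite ((\<lambda>w. w @ [1]) ` K 1)" "finite ((\<lambda>w. w @ [2]) ` K 2)"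
        using fin J(1) by auto
      note fins = this
      show ?thesis
        unfolding R(1) B prod.union_disjoint[OF finite_UnI[OF fins(1,2)] finite_UnI[OF fins(3,4)] disj(1)]
          prod.union_disjoint[OF fins(1,2) disj(2)] prod.union_disjoint[OF fins(3,4) disj(3)] ..
    qed
    also have "\<dots> = emeasure (PiM ?I (\<lambda>_. unif)) (prod_emb ?I (\<lambda>_. unif) J (Pi\<^sub>E J A))"
      unfolding J_eq[symmetric] using J A by (intro prod.emeasure_PiM_emb[symmetric]) auto
    finally show "emeasure (distr ?P shifts ?f) (prod_emb ?I (\<lambda>_. unif) J (Pi\<^sub>E J A))
        = emeasure (PiM ?I (\<lambda>_. unif)) (prod_emb ?I (\<lambda>_. unif) J (Pi\<^sub>E J A))" .
  qed (simp_all add: shifts_eq)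
  then show ?thesis
    by (simp add: shifts_eq)
qed

lemma measurable_nth_child [measurable]: "nth_child i \<in> M \<Otimes>\<^sub>M M \<rightarrow>\<^sub>M M"
  unfolding nth_child_def by simp

lemma nn_integral_nth_child:
  assumes "prob_space M" and [measurable]: "f \<in> borel_measurable M"
  shows "(\<integral>\<^sup>+p. f (nth_child i p) \<partial>(M \<Otimes>\<^sub>M M)) = (\<integral>\<^sup>+x. f x \<partial>M)"
proof -
  interpret prob_space M by fact
  show ?thesis
    using nn_integral_pair_mult[OF sigma_finite_measure_axioms assms(2), of "\<lambda>_. 1"]
      nn_integral_pair_mult[OF sigma_finite_measure_axioms _ assms(2), of "\<lambda>_. 1" M]
    by (cases "i = 1") (simp_all add: nth_child_def emeasure_space_1)
qed

lemma AE_nth_child: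
  assumes "prob_space M" and "AE x in M. Q x"
  shows "AE p in M \<Otimes>\<^sub>M M. Q (nth_child i p)"
proof -
  interpret prob_space M by fact
  have "distr (M \<Otimes>\<^sub>M M) M (nth_child i) = M"
  proof (rule measure_eqI)
    fix A assume "A \<in> sets (distr (M \<Otimes>\<^sub>M M) M (nth_child i))"
    then have [measurable]: "A \<in> sets M" by simp
    show "emeasure (distr (M \<Otimes>\<^sub>M M) M (nth_child i)) A = emeasure M A"
      using nn_integral_nth_child[OF assms(1), of "indicator A" i]
      by (subst nn_integral_indicator[symmetric], simp, subst nn_integral_distr) auto
  qed simp
  with assms(2) show ?thesis
    by (intro AE_distrD[of "nth_child i" "M \<Otimes>\<^sub>M M" M Q]) (auto simp only: measurable_nth_child)
qed

lemma nn_integral_shifts_graft: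
  assumes [measurable]: "F \<in> borel_measurable shifts"
  shows "(\<integral>\<^sup>+u. F u \<partial>shifts) = (\<integral>\<^sup>+x. \<integral>\<^sup>+y. F (graft x y) \<partial>shifts2 \<partial>root_law)"
proof -
  interpret S: prob_space shifts by (rule prob_space_shifts)
  interpret SS: pair_prob_space shifts shifts ..
  have "(\<integral>\<^sup>+u. F u \<partial>shifts) = (\<integral>\<^sup>+q. F (graft (fst q) (snd q)) \<partial>(root_law \<Otimes>\<^sub>M shifts2))"
    by (subst distr_graft[symmetric], subst nn_integral_distr) auto
  also have "\<dots> = (\<integral>\<^sup>+x. \<integral>\<^sup>+y. F (graft x y) \<partial>shifts2 \<partial>root_law)"
    by (subst SS.P.nn_integral_fst[symmetric]) auto
  finally show ?thesis .
qed

lemma measurable_graft' [measurable (raw)]: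
  assumes [measurable]: "f \<in> N \<rightarrow>\<^sub>M root_law" "k \<in> N \<rightarrow>\<^sub>M shifts2"
  shows "(\<lambda>z. graft (f z) (k z)) \<in> N \<rightarrow>\<^sub>M shifts"
proof -
  have "(\<lambda>z. (f z, k z)) \<in> N \<rightarrow>\<^sub>M root_law \<Otimes>\<^sub>M shifts2"
    by measurable
  from measurable_compose[OF this measurable_graft] show ?thesis by simp
qed

section \<open>Conditioning on the first generation\<close>

text \<open>The order of integration puts the first generation of both families outside, so that the positions of
the four child squares are fixed while the subtrees are integrated.\<close>

lemma nn_integral_shifts2_graft:
  assumes [measurable]: "F \<in> borel_measurable shifts2"
  shows "(\<integral>\<^sup>+p. F p \<partial>shifts2) =
    (\<integral>\<^sup>+x. \<integral>\<^sup>+x'. \<integral>\<^sup>+y. \<integral>\<^sup>+y'. F (graft x y, graft x' y') \<partial>shifts2 \<partial>shifts2 \<partial>root_law \<partial>root_law)"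
proof -
  interpret S: prob_space shifts by (rule prob_space_shifts)
  interpret SS: pair_prob_space shifts shifts ..
  interpret U: prob_space unif by (rule prob_space_unif)
  interpret UU: pair_prob_space unif unif ..
  interpret P: pair_sigma_finite root_law shifts2 ..
  have "(\<integral>\<^sup>+p. F p \<partial>shifts2) = (\<integral>\<^sup>+u. \<integral>\<^sup>+u'. F (u, u') \<partial>shifts \<partial>shifts)"
    by (subst S.nn_integral_fst[symmetric]) auto
  also have "\<dots> = (\<integral>\<^sup>+u. \<integral>\<^sup>+x'. \<integral>\<^sup>+y'. F (u, graft x' y') \<partial>shifts2 \<partial>root_law \<partial>shifts)"
    by (rule nn_integral_cong, rule nn_integral_shifts_graft) measurable
  also have "\<dots> = (\<integral>\<^sup>+x. \<integral>\<^sup>+y. \<integral>\<^sup>+x'. \<integral>\<^sup>+y'. F (graft x y, graft x' y')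
      \<partial>shifts2 \<partial>root_law \<partial>shifts2 \<partial>root_law)"
    by (rule nn_integral_shifts_graft) measurable
  also have "\<dots> = (\<integral>\<^sup>+x. \<integral>\<^sup>+x'. \<integral>\<^sup>+y. \<integral>\<^sup>+y'. F (graft x y, graft x' y')
      \<partial>shifts2 \<partial>shifts2 \<partial>root_law \<partial>root_law)"
    by (rule nn_integral_cong, rule P.Fubini') measurable
  finally show ?thesis .
qed

text \<open>Independence of the two diagonal squares: the first uses the first subtree of either family, the second
the second.\<close>

lemma nn_integral_shifts2_pair:
  assumes [measurable]: "F \<in> borel_measurable shifts2" "F' \<in> borel_measurable shifts2"
  shows "(\<integral>\<^sup>+y. \<integral>\<^sup>+y'. F (fst y, fst y') * F' (snd y, snd y') \<partial>shifts2 \<partial>shifts2)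
      = (\<integral>\<^sup>+p. F p \<partial>shifts2) * (\<integral>\<^sup>+p. F' p \<partial>shifts2)"
proof -
  interpret S: prob_space shifts by (rule prob_space_shifts)
  have "(\<integral>\<^sup>+y. \<integral>\<^sup>+y'. F (fst y, fst y') * F' (snd y, snd y') \<partial>shifts2 \<partial>shifts2)
      = (\<integral>\<^sup>+y. (\<integral>\<^sup>+u'. F (fst y, u') \<partial>shifts) * (\<integral>\<^sup>+u'. F' (snd y, u') \<partial>shifts) \<partial>shifts2)"
    by (intro nn_integral_cong nn_integral_pair_mult[OF S.sigma_finite_measure_axioms]) 
      (auto simp: space_pair_measure)
  also have "\<dots> = (\<integral>\<^sup>+u. \<integral>\<^sup>+u'. F (u, u') \<partial>shifts \<partial>shifts) * (\<integral>\<^sup>+u. \<integral>\<^sup>+u'. F' (u, u') \<partial>shifts \<partial>shifts)"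
    by (rule nn_integral_pair_mult[OF S.sigma_finite_measure_axioms]) measurable
  also have "\<dots> = (\<integral>\<^sup>+p. F p \<partial>shifts2) * (\<integral>\<^sup>+p. F' p \<partial>shifts2)"
    by (simp add: S.nn_integral_fst)
  finally show ?thesis .
qed

lemma nn_integral_shifts2_nth_child:
  assumes [measurable]: "F \<in> borel_measurable shifts2"
  shows "(\<integral>\<^sup>+y. \<integral>\<^sup>+y'. F (nth_child i y, nth_child j y') \<partial>shifts2 \<partial>shifts2) = (\<integral>\<^sup>+p. F p \<partial>shifts2)"
proof -
  interpret S: prob_space shifts by (rule prob_space_shifts)
  have "(\<integral>\<^sup>+y. \<integral>\<^sup>+y'. F (nth_child i y, nth_child j y') \<partial>shifts2 \<partial>shifts2)
      = (\<integral>\<^sup>+y. \<integral>\<^sup>+u'. F (nth_child i y, u') \<partial>shifts \<partial>shifts2)"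
  proof (rule nn_integral_cong)
    fix y assume "y \<in> space shifts2"
    then have "nth_child i y \<in> space shifts"
      using measurable_space[OF measurable_nth_child] by blast
    then show "(\<integral>\<^sup>+y'. F (nth_child i y, nth_child j y') \<partial>shifts2) = (\<integral>\<^sup>+u'. F (nth_child i y, u') \<partial>shifts)"
      by (intro nn_integral_nth_child[OF prob_space_shifts]) measurable
  qed
  also have "\<dots> = (\<integral>\<^sup>+u. \<integral>\<^sup>+u'. F (u, u') \<partial>shifts \<partial>shifts)"
    by (rule nn_integral_nth_child[OF prob_space_shifts]) measurable
  also have "\<dots> = (\<integral>\<^sup>+p. F p \<partial>shifts2)"
    by (simp add: S.nn_integral_fst)
  finally show ?thesis .
qed

lemma measurable_child_pos [measurable (raw)]:
  assumes [measurable]: "f \<in> N \<rightarrow>\<^sub>M borel \<Otimes>\<^sub>M borel" "k \<in> N \<rightarrow>\<^sub>M borel \<Otimes>\<^sub>M borel"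
  shows "(\<lambda>z. child_pos (f z) (k z) t i j) \<in> borel_measurable N"
  unfolding child_pos_def by measurable

lemma nn_integral_h_child_pos:
  "(\<integral>\<^sup>+x. \<integral>\<^sup>+x'. ennreal (h (child_pos x x' t i j)) \<partial>root_law \<partial>root_law)
    = ennreal a * (\<integral>\<^sup>+y. ennreal (tri (t - (offset j - offset i) - a * y) * h y) \<partial>lborel)"
proof -
  interpret U: prob_space unif by (rule prob_space_unif)
  let ?H = "\<lambda>z. ennreal (h ((t - (offset j - offset i) - z) / a))"
  have "(\<integral>\<^sup>+x. \<integral>\<^sup>+x'. ennreal (h (child_pos x x' t i j)) \<partial>root_law \<partial>root_law)
      = (\<integral>\<^sup>+x. \<integral>\<^sup>+x'. ?H (nth_child j x' - nth_child i x) \<partial>root_law \<partial>root_law)"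
    by (simp add: child_pos_def algebra_simps)
  also have "\<dots> = (\<integral>\<^sup>+x. \<integral>\<^sup>+z'. ?H (z' - nth_child i x) \<partial>unif \<partial>root_law)"
    by (rule nn_integral_cong, rule nn_integral_nth_child[OF prob_space_unif]) measurable
  also have "\<dots> = (\<integral>\<^sup>+z. \<integral>\<^sup>+z'. ?H (z' - z) \<partial>unif \<partial>unif)"
    by (rule nn_integral_nth_child[OF prob_space_unif]) measurable
  also have "\<dots> = (\<integral>\<^sup>+z. ennreal (tri z) * ?H z \<partial>lborel)"
    by (rule nn_integral_unif_diff) measurable
  also have "\<dots> = ennreal a * (\<integral>\<^sup>+y. ennreal (tri (t - (offset j - offset i) - a * y)) * ennreal (h y) \<partial>lborel)"
    by (subst nn_integral_real_affine[where c = "- a" and t = "t - (offset j - offset i)"])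
      (use a_pos in \<open>auto simp: algebra_simps\<close>)
  finally show ?thesis
    by (simp add: ennreal_mult tri_nonneg h_nonneg)
qed

text \<open>This is \<open>X\<^sub>1\<close> as a function of the shifts of the first generation.\<close>

definition offspring_dens :: "real \<times> real \<Rightarrow> real \<times> real \<Rightarrow> real \<Rightarrow> real" where
  "offspring_dens x x' t = (\<Sum>i\<in>{1, 2}. \<Sum>j\<in>{1, 2}. h (child_pos x x' t i j)) / growth"

lemma measurable_offspring_dens [measurable (raw)]:
  assumes [measurable]: "f \<in> N \<rightarrow>\<^sub>M borel \<Otimes>\<^sub>M borel" "k \<in> N \<rightarrow>\<^sub>M borel \<Otimes>\<^sub>M borel"
  shows "(\<lambda>z. offspring_dens (f z) (k z) t) \<in> borel_measurable N"
  unfolding offspring_dens_def by measurable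

lemma offspring_dens_nonneg: "0 \<le> offspring_dens x x' t"
  unfolding offspring_dens_def using a_pos by (intro divide_nonneg_nonneg sum_nonneg h_nonneg) simp

lemma offspring_dens_le: "offspring_dens x x' t \<le> 1 / (a * g)"
proof -
  have "(\<Sum>i\<in>{1, 2::nat}. \<Sum>j\<in>{1, 2::nat}. h (child_pos x x' t i j)) \<le> (\<Sum>i\<in>{1, 2::nat}. \<Sum>j\<in>{1, 2::nat}. 1 / g)"
    by (intro sum_mono h_le)
  then have "offspring_dens x x' t \<le> (4 / g) / growth"
    unfolding offspring_dens_def using a_pos by (intro divide_right_mono) auto
  then show ?thesis by (simp add: mult.commute)
qed

text \<open>The martingale property at the root.  Each child contributes its own translate of \<open>tri\<close>, the four
translates add up to \<open>4 * step_dens\<close>, and \<open>h_fixed_point\<close> applies.\<close>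

lemma nn_integral_offspring_dens:
  "(\<integral>\<^sup>+x. \<integral>\<^sup>+x'. ennreal (offspring_dens x x' t) \<partial>root_law \<partial>root_law) = ennreal (h t)"
proof -
  interpret U: prob_space unif by (rule prob_space_unif)
  interpret UU: pair_prob_space unif unif ..
  let ?T = "\<lambda>i j y. tri (t - (offset j - offset i) - a * y) * h y"
  have "ennreal (offspring_dens x x' t)
      = (\<Sum>i\<in>{1, 2}. \<Sum>j\<in>{1, 2}. ennreal (1 / growth) * ennreal (h (child_pos x x' t i j)))" for x x'
    unfolding offspring_dens_def using a_pos
    by (simp add: h_nonneg sum_divide_distrib ennreal_mult[symmetric] ennreal_plus[symmetric] add_divide_distrib
        del: ennreal_plus)
  then have "(\<integral>\<^sup>+x. \<integral>\<^sup>+x'. ennreal (offspring_dens x x' t) \<partial>root_law \<partial>root_law)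
      = (\<integral>\<^sup>+x. \<integral>\<^sup>+x'. (\<Sum>i\<in>{1, 2}. \<Sum>j\<in>{1, 2}. ennreal (1 / growth) * ennreal (h (child_pos x x' t i j)))
          \<partial>root_law \<partial>root_law)"
    by (simp only:)
  also have "\<dots> = (\<integral>\<^sup>+x. (\<Sum>i\<in>{1, 2}. \<Sum>j\<in>{1, 2}. ennreal (1 / growth) *
          (\<integral>\<^sup>+x'. ennreal (h (child_pos x x' t i j)) \<partial>root_law)) \<partial>root_law)"
    by (rule nn_integral_cong, rule nn_integral_double_sum_cmult, measurable)
      (auto simp: space_pair_measure intro: measurable_ident_sets sets_root_law)
  also have "\<dots> = (\<Sum>i\<in>{1, 2}. \<Sum>j\<in>{1, 2}. ennreal (1 / growth) *
          (\<integral>\<^sup>+x. \<integral>\<^sup>+x'. ennreal (h (child_pos x x' t i j)) \<partial>root_law \<partial>root_law))"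
    by (rule nn_integral_double_sum_cmult) measurable
  also have "\<dots> = (\<Sum>i\<in>{1, 2}. \<Sum>j\<in>{1, 2}. \<integral>\<^sup>+y. ennreal (1 / 4 * ?T i j y) \<partial>lborel)"
    using a_pos unfolding nn_integral_h_child_pos
    by (simp add: mult.assoc[symmetric] ennreal_mult[symmetric] nn_integral_cmult[symmetric] tri_nonneg h_nonneg)
  also have "\<dots> = (\<integral>\<^sup>+y. (\<Sum>i\<in>{1, 2}. \<Sum>j\<in>{1, 2}. ennreal (1 / 4 * ?T i j y)) \<partial>lborel)"
    by (simp add: nn_integral_add)
  also have "\<dots> = (\<integral>\<^sup>+y. ennreal (step_dens (t - a * y) * h y) \<partial>lborel)"
  proof (rule nn_integral_cong)
    fix y
    have "(\<Sum>i\<in>{1, 2::nat}. \<Sum>j\<in>{1, 2}. ennreal (1 / 4 * ?T i j y)) = ennreal (\<Sum>i\<in>{1, 2::nat}. \<Sum>j\<in>{1, 2}. 1 / 4 * ?T i j y)"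
      by (subst sum_ennreal[symmetric], simp add: sum_nonneg tri_nonneg h_nonneg,
          subst sum_ennreal) (simp_all add: tri_nonneg h_nonneg)
    also have "(\<Sum>i\<in>{1, 2::nat}. \<Sum>j\<in>{1, 2}. 1 / 4 * ?T i j y) = step_dens (t - a * y) * h y"
    proof -
      have off: "offset 2 - offset 1 = col_dist" "offset 1 - offset 2 = - col_dist"
        using g_eq by (simp_all add: offset_def col_dist_def field_simps)
      show ?thesis
        using off by (simp add: step_dens_def algebra_simps)
    qed
    finally show "(\<Sum>i\<in>{1, 2::nat}. \<Sum>j\<in>{1, 2}. ennreal (1 / 4 * ?T i j y)) = ennreal (step_dens (t - a * y) * h y)" .
  qed
  also have "\<dots> = ennreal (h t)"
    by (rule h_fixed_point[symmetric])
  finally show ?thesis .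
qed

section \<open>The exponential moment bound\<close>

text \<open>Half of the bound for \<open>X\<^sub>1\<close> in \<open>offspring_dens_le\<close>: it bounds \<open>E X\<^sub>1\<^sup>2 / 2\<close> by \<open>tilt_const * E X\<^sub>1\<close>.\<close>

definition tilt_const :: real where
  "tilt_const = 1 / (2 * a * g)"

text \<open>The compensator is proportional to \<open>X\<^sub>n\<close> itself and not to a bound for the number of squares: given the first
\<open>n\<close> levels, the variance of \<open>X\<^sub>n\<^sub>+\<^sub>1\<close> is at most a multiple of \<open>(4 a)\<^sup>-\<^sup>n X\<^sub>n\<close>.\<close>

definition tilt :: "nat \<Rightarrow> real \<Rightarrow> real \<Rightarrow> (nat list \<Rightarrow> real) \<times> (nat list \<Rightarrow> real) \<Rightarrow> ennreal" where
  "tilt n s t p = ennreal (exp (- s * dens (Suc n) (fst p) (snd p) t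
     + (s - tilt_const * s\<^sup>2 / growth ^ n) * dens n (fst p) (snd p) t))"

lemma measurable_tilt [measurable]: "tilt n s t \<in> borel_measurable shifts2"
  unfolding tilt_def by measurable

lemma tilt_eq_1:
  "admissible (fst p) \<Longrightarrow> admissible (snd p) \<Longrightarrow> 1 \<le> \<bar>t\<bar> \<Longrightarrow> tilt n s t p = 1"
  by (simp add: tilt_def dens_eq_0)

text \<open>Replacing \<open>s\<close> by \<open>s / growth\<close> reproduces the same exponent for the subtrees, because \<open>s\<^sup>2 / growth\<^sup>n\<close> then
loses one factor \<open>growth\<close> as the linear terms do.\<close>

lemma tilt_Suc_graft:
  "tilt (Suc n) s t (graft x y, graft x' y') =
     (\<Prod>i\<in>{1, 2}. \<Prod>j\<in>{1, 2}. tilt n (s / growth) (child_pos x x' t i j) (nth_child i y, nth_child j y'))"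
proof -
  let ?d = "\<lambda>m i j. dens m (nth_child i y) (nth_child j y') (child_pos x x' t i j)"
  let ?s = "s / growth" and ?I = "{1, 2 :: nat}"
  let ?e = "\<lambda>i j. - ?s * ?d (Suc n) i j + (?s - tilt_const * ?s\<^sup>2 / growth ^ n) * ?d n i j"
  have "- s * dens (Suc (Suc n)) (graft x y) (graft x' y') t
      + (s - tilt_const * s\<^sup>2 / growth ^ Suc n) * dens (Suc n) (graft x y) (graft x' y') t
      = - ?s * (\<Sum>i\<in>?I. \<Sum>j\<in>?I. ?d (Suc n) i j)
        + (?s - tilt_const * ?s\<^sup>2 / growth ^ n) * (\<Sum>i\<in>?I. \<Sum>j\<in>?I. ?d n i j)"
  proof -
    have coeff: "(s - tilt_const * s\<^sup>2 / growth ^ Suc n) / growth = ?s - tilt_const * ?s\<^sup>2 / growth ^ n"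
      using a_pos by (simp add: diff_divide_distrib power2_eq_square)
    have regroup: "- s * (A / growth) + r * (B / growth) = - ?s * A + (r / growth) * B" for A B r :: real
      by simp
    show ?thesis
      unfolding dens_graft regroup coeff ..
  qed
  also have "\<dots> = (\<Sum>i\<in>?I. \<Sum>j\<in>?I. ?e i j)"
    by (simp only: sum_distrib_left sum.distrib)
  finally have "tilt (Suc n) s t (graft x y, graft x' y') = ennreal (exp (\<Sum>i\<in>?I. \<Sum>j\<in>?I. ?e i j))"
    by (simp only: tilt_def fst_conv snd_conv)
  also have "\<dots> = (\<Prod>i\<in>?I. \<Prod>j\<in>?I. ennreal (exp (?e i j)))"
    by (simp only: exp_sum finite.emptyI finite.insertI prod_ennreal exp_ge_zero prod_nonneg)
  finally show ?thesis
    by (simp only: tilt_def fst_conv snd_conv)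
qed

text \<open>Here \<open>X\<^sub>0 = h t\<close> is deterministic and \<open>X\<^sub>1\<close> has mean \<open>h t\<close>, so the quadratic bound for the exponential
can be integrated and compared with \<open>exp\<close> again through \<open>1 + x \<le> exp x\<close>.\<close>

lemma nn_integral_tilt_0_le:
  assumes s: "0 \<le> s"
  shows "(\<integral>\<^sup>+p. tilt 0 s t p \<partial>shifts2) \<le> 1"
proof -
  interpret U: prob_space unif by (rule prob_space_unif)
  interpret UU: pair_prob_space unif unif ..
  interpret S: prob_space shifts by (rule prob_space_shifts)
  interpret SS: pair_prob_space shifts shifts ..
  let ?Y = "\<lambda>x x'. offspring_dens x x' t"
  let ?c = "tilt_const * s\<^sup>2"
  have c: "0 \<le> ?c"
    using a_pos g_pos by (simp add: tilt_const_def)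
  have [measurable]: "(\<lambda>x'. ?Y x x') \<in> borel_measurable root_law" for x
    by (measurable, auto simp: space_pair_measure intro: measurable_ident_sets sets_root_law)
  have "(\<lambda>x. \<integral>\<^sup>+x'. ennreal (?Y x x') \<partial>root_law) \<in> borel_measurable root_law"
    "(\<lambda>x. \<integral>\<^sup>+x'. ennreal (exp (- s * ?Y x x')) \<partial>root_law) \<in> borel_measurable root_law"
    by measurable
  note Y_meas = this
  define E where "E = (\<integral>\<^sup>+x. \<integral>\<^sup>+x'. ennreal (exp (- s * ?Y x x')) \<partial>root_law \<partial>root_law)"
  have tilt_graft: "tilt 0 s t (graft x y, graft x' y')
      = ennreal (exp ((s - ?c) * h t)) * ennreal (exp (- s * ?Y x x'))" for x x' y y'
    unfolding tilt_def fst_conv snd_conv dens_graft dens_0 offspring_dens_def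
    by (simp add: add.commute flip: ennreal_mult exp_add)
  have "(\<integral>\<^sup>+p. tilt 0 s t p \<partial>shifts2) = ennreal (exp ((s - ?c) * h t)) * E"
    unfolding E_def
    by (subst nn_integral_shifts2_graft)
      (simp_all add: tilt_graft SS.P.emeasure_space_1 nn_integral_cmult Y_meas)
  also have "E \<le> ennreal (exp (- ((s - ?c) * h t)))"
  proof -
    \<comment> \<open>The linear term is moved to the left, so that all four terms are nonnegative.\<close>
    have pointwise: "ennreal (exp (- s * ?Y x x')) + ennreal s * ennreal (?Y x x')
        \<le> 1 + ennreal ?c * ennreal (?Y x x')" for x x'
    proof -
      have Y: "0 \<le> ?Y x x'" "?Y x x' \<le> 1 / (a * g)"
        by (rule offspring_dens_nonneg offspring_dens_le)+
      have "s * ?Y x x' * (s * ?Y x x') \<le> s * ?Y x x' * (s * (1 / (a * g)))"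
        using Y s by (intro mult_left_mono) auto
      then have "(s * ?Y x x')\<^sup>2 / 2 \<le> ?c * ?Y x x'"
        by (simp add: tilt_const_def power2_eq_square mult_ac)
      then have "exp (- s * ?Y x x') + s * ?Y x x' \<le> 1 + ?c * ?Y x x'"
        using exp_minus_le_quadratic[of "s * ?Y x x'"] s Y by simp
      then have "ennreal (exp (- s * ?Y x x') + s * ?Y x x') \<le> ennreal (1 + ?c * ?Y x x')"
        by (rule ennreal_leI)
      then show ?thesis
        using s Y c by (simp add: ennreal_mult)
    qed
    have "E + ennreal s * ennreal (h t)
        = (\<integral>\<^sup>+x. \<integral>\<^sup>+x'. ennreal (exp (- s * ?Y x x')) + ennreal s * ennreal (?Y x x') \<partial>root_law \<partial>root_law)"
      unfolding E_def nn_integral_offspring_dens[symmetric]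
      by (simp add: nn_integral_add nn_integral_cmult Y_meas)
    also have "\<dots> \<le> (\<integral>\<^sup>+x. \<integral>\<^sup>+x'. 1 + ennreal ?c * ennreal (?Y x x') \<partial>root_law \<partial>root_law)"
      by (intro nn_integral_mono pointwise)
    also have "\<dots> = 1 + ennreal ?c * ennreal (h t)"
      unfolding nn_integral_offspring_dens[symmetric]
      by (simp add: nn_integral_add nn_integral_cmult Y_meas UU.P.emeasure_space_1)
    finally have le: "E + ennreal (s * h t) \<le> ennreal (1 + ?c * h t)"
      using s c h_nonneg[of t] by (simp add: ennreal_mult)
    then have "E \<noteq> \<top>"
      by (auto simp: top_unique)
    then obtain e where e: "E = ennreal e" "0 \<le> e"
      by (cases E) auto
    have "e + s * h t \<le> 1 + ?c * h t"
      using le s c h_nonneg[of t] e by (simp flip: ennreal_plus)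
    also have "1 + ?c * h t - s * h t \<le> exp (- ((s - ?c) * h t))"
      using exp_ge_add_one_self[of "- ((s - ?c) * h t)"] by (simp add: algebra_simps)
    finally show ?thesis
      using e by (simp add: ennreal_leI)
  qed
  finally have "(\<integral>\<^sup>+p. tilt 0 s t p \<partial>shifts2)
      \<le> ennreal (exp ((s - ?c) * h t)) * ennreal (exp (- ((s - ?c) * h t)))"
    by (simp add: mult_left_mono)
  also have "\<dots> = 1"
    by (simp flip: ennreal_mult exp_add)
  finally show ?thesis .
qed

text \<open>The line crosses the interior of the child square in column \<open>i\<close> and row \<open>j\<close>.\<close>

definition live :: "real \<times> real \<Rightarrow> real \<times> real \<Rightarrow> real \<Rightarrow> nat \<Rightarrow> nat \<Rightarrow> bool" where
  "live x x' t i j \<longleftrightarrow> \<bar>child_pos x x' t i j\<bar> < 1"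

lemma live_iff:
  "live x x' t i j \<longleftrightarrow> \<bar>t - (offset j + nth_child j x') + (offset i + nth_child i x)\<bar> < a"
  using a_pos by (simp add: live_def child_pos_def abs_divide)

text \<open>The left endpoints of two child intervals of one parent differ by at least \<open>col_dist - g = 2 * a\<close> in units of the
parent.  A line crossing two squares in one row or one column would need a difference below \<open>2 * a\<close>.
For the two off-diagonal squares the corresponding distance is twice as large.\<close>

lemma live_exclusive:
  assumes "\<forall>i. 0 \<le> nth_child i x \<and> nth_child i x \<le> g" "\<forall>i. 0 \<le> nth_child i x' \<and> nth_child i x' \<le> g"
  shows "live x x' t 1 2 \<Longrightarrow> \<not> live x x' t 1 1 \<and> \<not> live x x' t 2 2 \<and> \<not> live x x' t 2 1"
    and "live x x' t 2 1 \<Longrightarrow> \<not> live x x' t 1 1 \<and> \<not> live x x' t 2 2 \<and> \<not> live x x' t 1 2"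
proof -
  have "0 \<le> fst x" "fst x \<le> g" "0 \<le> snd x" "snd x \<le> g"
    "0 \<le> fst x'" "fst x' \<le> g" "0 \<le> snd x'" "snd x' \<le> g"
    using assms by (metis nth_child_simps(1,3))+
  moreover have "offset 2 - offset 1 = g + 2 * a"
    using g_eq by (simp add: offset_def field_simps)
  ultimately show "live x x' t 1 2 \<Longrightarrow> \<not> live x x' t 1 1 \<and> \<not> live x x' t 2 2 \<and> \<not> live x x' t 2 1"
    and "live x x' t 2 1 \<Longrightarrow> \<not> live x x' t 1 1 \<and> \<not> live x x' t 2 2 \<and> \<not> live x x' t 1 2"
    unfolding live_iff nth_child_simps using a_pos by linarith+
qed

lemma AE_root_law: "AE x in root_law. \<forall>i. 0 \<le> nth_child i x \<and> nth_child i x \<le> g"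
proof -
  have "AE x in root_law. 0 \<le> nth_child i x \<and> nth_child i x \<le> g" for i
    by (rule AE_nth_child[OF prob_space_unif AE_unif])
  then show ?thesis by (simp add: AE_all_countable)
qed

lemma AE_shifts2: "AE y in shifts2. \<forall>i. admissible (nth_child i y)"
  by (intro AE_all_countable[THEN iffD2] allI AE_nth_child prob_space_shifts AE_admissible)

text \<open>A square that the line misses contributes the factor one.  By \<open>live_exclusive\<close> the remaining factors
belong either to one square, where the induction hypothesis applies directly, or to the two
diagonal squares, where the integral is a product of two integrals.\<close>

theorem nn_integral_tilt_le:
  assumes "0 \<le> s"
  shows "(\<integral>\<^sup>+p. tilt n s t p \<partial>shifts2) \<le> 1"
  using assms
proof (induction n arbitrary: s t)
  case 0
  then show ?case by (rule nn_integral_tilt_0_le)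
next
  case (Suc n)
  interpret U: prob_space unif by (rule prob_space_unif)
  interpret UU: pair_prob_space unif unif ..
  have IH: "(\<integral>\<^sup>+p. tilt n (s / growth) r p \<partial>shifts2) \<le> 1" for r
    using Suc.IH[of "s / growth" r] Suc.prems a_pos by simp
  have cond: "(\<integral>\<^sup>+y. \<integral>\<^sup>+y'. tilt (Suc n) s t (graft x y, graft x' y') \<partial>shifts2 \<partial>shifts2) \<le> 1"
    if x: "\<forall>i. 0 \<le> nth_child i x \<and> nth_child i x \<le> g"
      and x': "\<forall>i. 0 \<le> nth_child i x' \<and> nth_child i x' \<le> g" for x x'
  proof -
    define T where "T i j = tilt n (s / growth) (child_pos x x' t i j)" for i j
    have [measurable]: "T i j \<in> borel_measurable shifts2" for i j
      unfolding T_def by measurable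
    have T_le: "(\<integral>\<^sup>+p. T i j p \<partial>shifts2) \<le> 1" for i j
      unfolding T_def by (rule IH)
    have graft_eq: "tilt (Suc n) s t (graft x y, graft x' y') =
        T 1 1 (fst y, fst y') * T 1 2 (fst y, snd y') * (T 2 1 (snd y, fst y') * T 2 2 (snd y, snd y'))" for y y'
      by (simp add: tilt_Suc_graft T_def)
    have dead: "T i j (nth_child i y, nth_child j y') = 1"
      if "\<not> live x x' t i j" "\<forall>i. admissible (nth_child i y)" "\<forall>i. admissible (nth_child i y')" for i j y y'
      using that by (simp add: T_def live_def tilt_eq_1)
    have dead': "\<not> live x x' t 1 1 \<Longrightarrow> T 1 1 (fst y, fst y') = 1"
      "\<not> live x x' t 1 2 \<Longrightarrow> T 1 2 (fst y, snd y') = 1"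
      "\<not> live x x' t 2 1 \<Longrightarrow> T 2 1 (snd y, fst y') = 1"
      "\<not> live x x' t 2 2 \<Longrightarrow> T 2 2 (snd y, snd y') = 1"
      if "\<forall>i. admissible (nth_child i y)" "\<forall>i. admissible (nth_child i y')" for y y'
      using dead[OF _ that, of 1 1] dead[OF _ that, of 1 2] dead[OF _ that, of 2 1] dead[OF _ that, of 2 2]
      unfolding nth_child_simps by blast+
    \<comment> \<open>Factors of missed squares equal one on admissible shifts, that is almost everywhere.\<close>
    have reduce: "(\<integral>\<^sup>+y. \<integral>\<^sup>+y'. tilt (Suc n) s t (graft x y, graft x' y') \<partial>shifts2 \<partial>shifts2)
        = (\<integral>\<^sup>+y. \<integral>\<^sup>+y'. R y y' \<partial>shifts2 \<partial>shifts2)"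
      if "\<And>y y'. \<forall>i. admissible (nth_child i y) \<Longrightarrow> \<forall>i. admissible (nth_child i y') \<Longrightarrow>
        tilt (Suc n) s t (graft x y, graft x' y') = R y y'" for R
      using AE_shifts2
    proof (intro nn_integral_cong_AE, eventually_elim)
      case (elim y)
      then show ?case
        by (intro nn_integral_cong_AE eventually_mono[OF AE_shifts2] that)
    qed
    consider "live x x' t 1 2" | "live x x' t 2 1" | "\<not> live x x' t 1 2" "\<not> live x x' t 2 1"
      by blast
    then show ?thesis
    proof cases
      case 1
      have "(\<integral>\<^sup>+y. \<integral>\<^sup>+y'. tilt (Suc n) s t (graft x y, graft x' y') \<partial>shifts2 \<partial>shifts2)
          = (\<integral>\<^sup>+y. \<integral>\<^sup>+y'. T 1 2 (nth_child 1 y, nth_child 2 y') \<partial>shifts2 \<partial>shifts2)"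
        using live_exclusive(1)[OF x x' 1] by (intro reduce) (simp add: graft_eq dead' del: One_nat_def)
      also have "\<dots> = (\<integral>\<^sup>+p. T 1 2 p \<partial>shifts2)"
        by (rule nn_integral_shifts2_nth_child) measurable
      finally show ?thesis using T_le by simp
    next
      case 2
      have "(\<integral>\<^sup>+y. \<integral>\<^sup>+y'. tilt (Suc n) s t (graft x y, graft x' y') \<partial>shifts2 \<partial>shifts2)
          = (\<integral>\<^sup>+y. \<integral>\<^sup>+y'. T 2 1 (nth_child 2 y, nth_child 1 y') \<partial>shifts2 \<partial>shifts2)"
        using live_exclusive(2)[OF x x' 2] by (intro reduce) (simp add: graft_eq dead' del: One_nat_def)
      also have "\<dots> = (\<integral>\<^sup>+p. T 2 1 p \<partial>shifts2)"
        by (rule nn_integral_shifts2_nth_child) measurable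
      finally show ?thesis using T_le by simp
    next
      case 3
      have "(\<integral>\<^sup>+y. \<integral>\<^sup>+y'. tilt (Suc n) s t (graft x y, graft x' y') \<partial>shifts2 \<partial>shifts2)
          = (\<integral>\<^sup>+y. \<integral>\<^sup>+y'. T 1 1 (fst y, fst y') * T 2 2 (snd y, snd y') \<partial>shifts2 \<partial>shifts2)"
        using 3 by (intro reduce) (simp add: graft_eq dead' del: One_nat_def)
      also have "\<dots> = (\<integral>\<^sup>+p. T 1 1 p \<partial>shifts2) * (\<integral>\<^sup>+p. T 2 2 p \<partial>shifts2)"
        by (rule nn_integral_shifts2_pair) measurable
      also have "\<dots> \<le> 1 * 1"
        by (intro mult_mono T_le) auto
      finally show ?thesis by simp
    qed
  qed
  have "(\<integral>\<^sup>+p. tilt (Suc n) s t p \<partial>shifts2) =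
      (\<integral>\<^sup>+x. \<integral>\<^sup>+x'. \<integral>\<^sup>+y. \<integral>\<^sup>+y'. tilt (Suc n) s t (graft x y, graft x' y')
        \<partial>shifts2 \<partial>shifts2 \<partial>root_law \<partial>root_law)"
    by (rule nn_integral_shifts2_graft) measurable
  also have "\<dots> \<le> (\<integral>\<^sup>+x. \<integral>\<^sup>+x'. 1 \<partial>root_law \<partial>root_law)"
    using AE_root_law
  proof (intro nn_integral_mono_AE, eventually_elim)
    case (elim x)
    then show ?case
      by (intro nn_integral_mono_AE eventually_mono[OF AE_root_law] cond)
  qed
  also have "\<dots> = 1"
    by (simp add: UU.P.emeasure_space_1)
  finally show ?case .
qed

section \<open>Regularity and total mass\<close>

lemma sum_words_const: "(\<Sum>v\<in>words_of n. \<Sum>w\<in>words_of n. x) = 4 ^ n * (x :: real)"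
proof -
  have "real (2 ^ n) * real (2 ^ n) = 4 ^ n"
    by (simp add: power_mult_distrib[symmetric])
  then show ?thesis
    by (simp only: sum_constant card_words_of mult.assoc[symmetric])
qed

text \<open>All \<open>4\<^sup>n\<close> terms are counted although few are nonzero.  Any bound of exponential growth
serves, since the probabilities it competes with decay doubly exponentially.\<close>

lemma dens_lipschitz: "\<bar>dens n u u' t - dens n u u' t'\<bar> \<le> 16 ^ n / g\<^sup>2 * \<bar>t - t'\<bar>"
proof -
  let ?f = "\<lambda>t v w. h ((t - left u' w + left u v) / a ^ n)"
  let ?B = "\<bar>t - t'\<bar> / a ^ n / g\<^sup>2"
  have "\<bar>(\<Sum>v\<in>words_of n. \<Sum>w\<in>words_of n. ?f t v w) - (\<Sum>v\<in>words_of n. \<Sum>w\<in>words_of n. ?f t' v w)\<bar>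
      = \<bar>\<Sum>v\<in>words_of n. \<Sum>w\<in>words_of n. ?f t v w - ?f t' v w\<bar>"
    by (simp only: sum_subtractf)
  also have "\<dots> \<le> (\<Sum>v\<in>words_of n. \<Sum>w\<in>words_of n. ?B)"
  proof (intro order_trans[OF sum_abs] sum_mono)
    fix v w
    have "(t - left u' w + left u v) / a ^ n - (t' - left u' w + left u v) / a ^ n = (t - t') / a ^ n"
      by (simp add: diff_divide_distrib[symmetric])
    then show "\<bar>?f t v w - ?f t' v w\<bar> \<le> ?B"
      using h_lipschitz[of "(t - left u' w + left u v) / a ^ n" "(t' - left u' w + left u v) / a ^ n"] a_pos
      by (simp add: abs_divide)
  qed
  also have "\<dots> = 4 ^ n * ?B"
    by (rule sum_words_const)
  finally have "\<bar>dens n u u' t - dens n u u' t'\<bar> \<le> 4 ^ n * ?B / growth ^ n"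
  proof -
    assume le: "\<bar>(\<Sum>v\<in>words_of n. \<Sum>w\<in>words_of n. ?f t v w) - (\<Sum>v\<in>words_of n. \<Sum>w\<in>words_of n. ?f t' v w)\<bar>
      \<le> 4 ^ n * ?B"
    have "\<bar>growth ^ n\<bar> = growth ^ n"
      using a_pos by simp
    then show ?thesis
      unfolding dens_def diff_divide_distrib[symmetric] abs_divide
      using le a_pos by (simp only: divide_right_mono zero_le_power zero_le_mult_iff less_imp_le zero_le_numeral simp_thms)
  qed
  also have "\<dots> = (1 / a\<^sup>2) ^ n / g\<^sup>2 * \<bar>t - t'\<bar>"
    using a_pos by (simp add: power_mult_distrib power2_eq_square field_simps)
  also have "\<dots> \<le> 16 ^ n / g\<^sup>2 * \<bar>t - t'\<bar>"
  proof (intro mult_right_mono divide_right_mono power_mono)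
    have "(1 / 4)\<^sup>2 \<le> a\<^sup>2"
      using a_gt by (intro power_mono) auto
    then show "1 / a\<^sup>2 \<le> 16"
      using a_pos by (simp add: field_simps power2_eq_square)
  qed auto
  finally show ?thesis .
qed

lemma continuous_dens: "continuous_on UNIV (dens n u u')"
proof -
  have "(16 ^ n / g\<^sup>2)-lipschitz_on UNIV (dens n u u')"
    using dens_lipschitz by (intro lipschitz_onI) (auto simp: dist_real_def)
  then show ?thesis by (rule lipschitz_on_continuous_on)
qed

text \<open>Every one of the \<open>4\<^sup>n\<close> squares contributes \<open>a\<^sup>n / growth\<^sup>n\<close>, whatever the shifts are.\<close>

lemma nn_integral_dens: "(\<integral>\<^sup>+t. ennreal (dens n u u' t) \<partial>lborel) = 1"
proof -
  have affine: "(\<integral>\<^sup>+t. ennreal (h ((t - m + l) / a ^ n)) \<partial>lborel) = ennreal (a ^ n)" for m l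
    by (subst nn_integral_real_affine[where c = "a ^ n" and t = "m - l"])
      (use a_pos in \<open>auto simp: nn_integral_h algebra_simps\<close>)
  have "ennreal (dens n u u' t) = (\<Sum>v\<in>words_of n. \<Sum>w\<in>words_of n.
      ennreal (1 / growth ^ n) * ennreal (h ((t - left u' w + left u v) / a ^ n)))" for t
  proof -
    have "dens n u u' t = (\<Sum>v\<in>words_of n. \<Sum>w\<in>words_of n.
        1 / growth ^ n * h ((t - left u' w + left u v) / a ^ n))"
      unfolding dens_def by (simp add: sum_divide_distrib)
    then show ?thesis
      using a_pos by (simp add: ennreal_mult[symmetric] sum_ennreal h_nonneg sum_nonneg)
  qed
  then have "(\<integral>\<^sup>+t. ennreal (dens n u u' t) \<partial>lborel)
      = (\<integral>\<^sup>+t. (\<Sum>v\<in>words_of n. \<Sum>w\<in>words_of n.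
          ennreal (1 / growth ^ n) * ennreal (h ((t - left u' w + left u v) / a ^ n))) \<partial>lborel)"
    by (simp only:)
  also have "\<dots> = (\<Sum>v\<in>words_of n. \<Sum>w\<in>words_of n. ennreal (1 / growth ^ n) *
      (\<integral>\<^sup>+t. ennreal (h ((t - left u' w + left u v) / a ^ n)) \<partial>lborel))"
    by (rule nn_integral_double_sum_cmult) measurable
  also have "\<dots> = (\<Sum>v\<in>words_of n. \<Sum>w\<in>words_of n. ennreal (1 / growth ^ n * a ^ n))"
    using a_pos by (simp only: affine) (simp flip: ennreal_mult)
  also have "\<dots> = (\<Sum>v\<in>words_of n. ennreal (\<Sum>w\<in>words_of n. 1 / growth ^ n * a ^ n))"
    using a_pos by (intro sum.cong refl sum_ennreal) simp
  also have "\<dots> = ennreal (\<Sum>v\<in>words_of n. \<Sum>w\<in>words_of n. 1 / growth ^ n * a ^ n)"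
    using a_pos by (intro sum_ennreal sum_nonneg) simp
  also have "(\<Sum>v\<in>words_of n. \<Sum>w\<in>words_of n. 1 / growth ^ n * a ^ n) = 4 ^ n * (1 / growth ^ n * a ^ n)"
    by (simp only: sum_words_const)
  also have "4 ^ n * (1 / growth ^ n * a ^ n) = 1"
    using a_pos by (simp add: power_mult_distrib)
  finally show ?thesis by simp
qed

lemma ex_dens_large:
  assumes "admissible u" "admissible u'"
  shows "\<exists>t. \<bar>t\<bar> < 1 \<and> 1 / 4 \<le> dens n u u' t"
proof (rule ccontr)
  assume *: "\<not> ?thesis"
  have "ennreal (dens n u u' t) \<le> ennreal (1 / 4) * indicator {-1..1} t" for t
  proof (cases "\<bar>t\<bar> < 1")
    case True
    with * have "dens n u u' t < 1 / 4" by (auto simp: not_le)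
    with True show ?thesis by (auto simp: indicator_def intro!: ennreal_leI)
  next
    case False
    then show ?thesis using dens_eq_0[OF assms, of t n] by simp
  qed
  then have "(\<integral>\<^sup>+t. ennreal (dens n u u' t) \<partial>lborel) \<le> (\<integral>\<^sup>+t. ennreal (1 / 4) * indicator {-1..1::real} t \<partial>lborel)"
    by (intro nn_integral_mono) auto
  also have "\<dots> = ennreal (1 / 4) * ennreal 2"
    by (subst nn_integral_cmult_indicator) auto
  also have "\<dots> = ennreal (1 / 2)"
    by (subst ennreal_mult[symmetric]) auto
  finally have "1 \<le> ennreal (1 / 2)"
    by (simp only: nn_integral_dens)
  then show False
    by (subst (asm) ennreal_1[symmetric], subst (asm) ennreal_le_iff) auto
qed

section \<open>Almost sure control of the losses\<close>

text \<open>The fourth root leaves room for three scales: with \<open>s = rate\<^sup>2\<^sup>n\<close> the compensator \<open>s\<^sup>2 / growth\<^sup>n\<close> equals one,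
an excess of \<open>rate\<^sup>n\<close> in the exponent has probability \<open>exp (- rate\<^sup>n)\<close>, and it corresponds to a loss of
only \<open>rate\<^sup>n / s = rate\<^sup>-\<^sup>n\<close>.\<close>

definition rate :: real where
  "rate = root 4 growth"

lemma rate_gt_1: "1 < rate" and rate_power: "rate ^ 4 = growth"
  using a_gt by (simp_all add: rate_def real_root_gt_1_iff)

lemma tilt_rate:
  "tilt n (rate ^ (2 * n)) t p = ennreal (exp (rate ^ (2 * n) * (dens n (fst p) (snd p) t - dens (Suc n) (fst p) (snd p) t)
      - tilt_const * dens n (fst p) (snd p) t))"
proof -
  have sq: "(rate ^ (2 * n))\<^sup>2 = growth ^ n"
    unfolding rate_power[symmetric] by (simp add: power_mult[symmetric] mult.commute)
  have "growth ^ n \<noteq> 0"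
    using a_pos by simp
  then have compensator: "tilt_const * (rate ^ (2 * n))\<^sup>2 / growth ^ n = tilt_const"
    unfolding sq by (rule nonzero_mult_div_cancel_right)
  show ?thesis
    unfolding tilt_def compensator
    by (intro arg_cong[where f = "\<lambda>x. ennreal (exp x)"]) (simp add: left_diff_distrib right_diff_distrib)
qed

text \<open>Outside this event the loss \<open>X\<^sub>n t - X\<^sub>n\<^sub>+\<^sub>1 t\<close> is less than \<open>tilt_const * X\<^sub>n t / rate\<^sup>2\<^sup>n + 1 / rate\<^sup>n\<close>.\<close>

definition deficit_event :: "nat \<Rightarrow> real \<Rightarrow> ((nat list \<Rightarrow> real) \<times> (nat list \<Rightarrow> real)) set" where
  "deficit_event n t = {p \<in> space shifts2. ennreal (exp (rate ^ n)) \<le> tilt n (rate ^ (2 * n)) t p}"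

lemma deficit_event_sets [measurable]: "deficit_event n t \<in> sets shifts2"
  unfolding deficit_event_def by measurable

lemma emeasure_deficit_event_le: "emeasure shifts2 (deficit_event n t) \<le> ennreal (exp (- (rate ^ n)))"
proof -
  let ?c = "ennreal (exp (- (rate ^ n)))" and ?T = "tilt n (rate ^ (2 * n)) t"
  have "deficit_event n t \<subseteq> {p \<in> space shifts2. 1 \<le> ?c * ?T p}"
  proof
    fix p assume p: "p \<in> deficit_event n t"
    then have "?c * ennreal (exp (rate ^ n)) \<le> ?c * ?T p"
      by (intro mult_left_mono) (auto simp: deficit_event_def)
    then show "p \<in> {p \<in> space shifts2. 1 \<le> ?c * ?T p}"
      using p by (simp add: deficit_event_def ennreal_mult[symmetric] exp_add[symmetric])
  qed
  then have "emeasure shifts2 (deficit_event n t) \<le> emeasure shifts2 {p \<in> space shifts2. 1 \<le> ?c * ?T p}"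
    by (intro emeasure_mono) measurable
  also have "\<dots> \<le> ?c * (\<integral>\<^sup>+p. ?T p * indicator (space shifts2) p \<partial>shifts2)"
    using nn_integral_Markov_inequality[of ?T "space shifts2" shifts2 ?c] by (simp add: conj_commute)
  also have "(\<integral>\<^sup>+p. ?T p * indicator (space shifts2) p \<partial>shifts2) = (\<integral>\<^sup>+p. ?T p \<partial>shifts2)"
    by (intro nn_integral_cong) simp
  also have "?c * (\<integral>\<^sup>+p. ?T p \<partial>shifts2) \<le> ?c * 1"
    using rate_gt_1 by (intro mult_left_mono nn_integral_tilt_le) auto
  finally show ?thesis by simp
qed

text \<open>A mesh of \<open>64\<^sup>-\<^sup>n\<close> beats the Lipschitz constant, which is of order \<open>16\<^sup>n\<close>.\<close>

definition grid :: "nat \<Rightarrow> real set" where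
  "grid n = (\<lambda>k. real_of_int k / 64 ^ n) ` {- (64 ^ n)..64 ^ n}"

lemma finite_grid: "finite (grid n)"
  by (simp add: grid_def)

lemma card_grid_le: "real (card (grid n)) \<le> 3 * 64 ^ n"
proof -
  have "card (grid n) \<le> card {- (64 ^ n)..64 ^ n :: int}"
    unfolding grid_def by (rule card_image_le) simp
  also have "\<dots> = nat (2 * 64 ^ n + 1)"
    by (simp add: algebra_simps)
  finally have "real (card (grid n)) \<le> real (nat (2 * 64 ^ n + 1))"
    by (simp only: of_nat_le_iff)
  also have "\<dots> = 2 * 64 ^ n + 1"
    by simp
  also have "\<dots> \<le> 3 * 64 ^ n"
    by simp
  finally show ?thesis .
qed

lemma grid_dense:
  assumes "\<bar>t\<bar> \<le> 1"
  obtains t' where "t' \<in> grid n" "\<bar>t - t'\<bar> \<le> 1 / 64 ^ n"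
proof
  let ?k = "\<lfloor>t * 64 ^ n\<rfloor>"
  have "- (64 ^ n) \<le> t * 64 ^ n" "t * 64 ^ n \<le> 64 ^ n"
    using assms mult_right_mono[of "- 1" t "64 ^ n"] mult_right_mono[of t 1 "64 ^ n"] by auto
  moreover from this have "t * 64 ^ n < 64 ^ n + 1"
    by linarith
  ultimately have "- (64 ^ n) \<le> ?k" "?k \<le> 64 ^ n"
    by (auto simp: le_floor_iff floor_le_iff)
  then show "real_of_int ?k / 64 ^ n \<in> grid n"
    unfolding grid_def by auto
  have "\<bar>t * 64 ^ n - real_of_int ?k\<bar> \<le> 1"
    by linarith
  then have "\<bar>t * 64 ^ n - real_of_int ?k\<bar> / 64 ^ n \<le> 1 / 64 ^ n"
    by (intro divide_right_mono) auto
  moreover have "t - real_of_int ?k / 64 ^ n = (t * 64 ^ n - real_of_int ?k) / 64 ^ n"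
    by (simp add: diff_divide_distrib)
  ultimately show "\<bar>t - real_of_int ?k / 64 ^ n\<bar> \<le> 1 / 64 ^ n"
    by simp
qed

lemma summable_grid_exp: "summable (\<lambda>n. 3 * 64 ^ n * exp (- (rate ^ n)))"
proof (rule summable_comparison_test_bigo)
  show "summable (\<lambda>n. norm ((1 / 2 :: real) ^ n))"
    by (simp add: summable_geometric)
  show "(\<lambda>n. 3 * 64 ^ n * exp (- (rate ^ n))) \<in> O(\<lambda>n. (1 / 2 :: real) ^ n)"
    using rate_gt_1 by real_asymp
qed

lemma AE_eventually_no_deficit: "AE p in shifts2. \<forall>\<^sub>F n in sequentially. \<forall>t\<in>grid n. p \<notin> deficit_event n t"
proof -
  interpret S: prob_space shifts by (rule prob_space_shifts)
  interpret SS: pair_prob_space shifts shifts ..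
  let ?A = "\<lambda>n. \<Union>t\<in>grid n. deficit_event n t"
  have "AE p in shifts2. \<forall>\<^sub>F n in sequentially. p \<in> space shifts2 - ?A n"
  proof (rule borel_cantelli_AE1)
    show A: "?A n \<in> sets shifts2" for n
      using finite_grid by (intro sets.finite_UN) auto
    show "emeasure shifts2 (?A n) < \<infinity>" for n
      by (simp add: less_top[symmetric])
    show "summable (\<lambda>n. measure shifts2 (?A n))"
    proof (rule summable_comparison_test'[OF summable_grid_exp])
      fix n
      have "measure shifts2 (deficit_event n t) \<le> exp (- (rate ^ n))" for t
        using emeasure_deficit_event_le[of n t] by (simp add: SS.P.emeasure_eq_measure)
      then have "measure shifts2 (?A n) \<le> (\<Sum>t\<in>grid n. exp (- (rate ^ n)))"
        by (intro order_trans[OF SS.P.finite_measure_subadditive_finite[OF finite_grid]] sum_mono) auto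
      also have "\<dots> \<le> 3 * 64 ^ n * exp (- (rate ^ n))"
        using card_grid_le[of n] by (simp add: mult_right_mono)
      finally show "norm (measure shifts2 (?A n)) \<le> 3 * 64 ^ n * exp (- (rate ^ n))"
        by simp
    qed
  qed
  then show ?thesis
    by (rule eventually_mono) (auto elim!: eventually_mono)
qed

text \<open>The first two terms come from the bound at a grid point, the third from moving to the grid point and
back: \<open>X\<^sub>n\<close> and \<open>X\<^sub>n\<^sub>+\<^sub>1\<close> change by at most \<open>4\<^sup>-\<^sup>n / g\<^sup>2\<close> and \<open>16 * 4\<^sup>-\<^sup>n / g\<^sup>2\<close>.\<close>

definition loss :: "nat \<Rightarrow> real" where
  "loss n = tilt_const * (1 + 1 / g\<^sup>2) * (1 / rate ^ 2) ^ n + (1 / rate) ^ n + 17 / g\<^sup>2 * (1 / 4) ^ n"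

lemma tilt_const_nonneg: "0 \<le> tilt_const"
  using a_pos g_pos by (simp add: tilt_const_def)

lemma loss_nonneg: "0 \<le> loss n"
  using tilt_const_nonneg rate_gt_1 by (auto simp: loss_def intro!: add_nonneg_nonneg mult_nonneg_nonneg)

lemma summable_loss: "summable loss"
proof -
  have "1 < rate\<^sup>2"
    using rate_gt_1 by (simp add: one_less_power)
  then have "norm (1 / rate\<^sup>2) < 1" "norm (1 / rate) < 1" "norm (1 / 4 :: real) < 1"
    using rate_gt_1 by (simp_all add: divide_less_eq)
  note summable_geometric[OF this(1)] summable_geometric[OF this(2)] summable_geometric[OF this(3)]
  then show ?thesis
    unfolding loss_def by (intro summable_add summable_mult)
qed

text \<open>Stated for \<open>1 + X\<^sub>n\<close>, since in this form the losses of successive levels compose multiplicatively.\<close>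

lemma dens_Suc_lower:
  assumes p: "(u, u') \<in> space shifts2"
    and grid: "\<And>t. t \<in> grid n \<Longrightarrow> (u, u') \<notin> deficit_event n t" and t: "\<bar>t\<bar> \<le> 1"
  shows "(1 + dens n u u' t) * (1 - loss n) \<le> 1 + dens (Suc n) u u' t"
proof -
  obtain t' where t': "t' \<in> grid n" "\<bar>t - t'\<bar> \<le> 1 / 64 ^ n"
    using grid_dense[OF t] .
  let ?X = "dens n u u'" and ?Y = "dens (Suc n) u u'"
  let ?L = "1 / g\<^sup>2" and ?r = "1 / rate ^ 2" and ?e = "(1 / 4 :: real) ^ n" and ?c = tilt_const
  have rn: "?r ^ n * rate ^ (2 * n) = 1" "0 \<le> ?r ^ n" "?r ^ n * rate ^ n = (1 / rate) ^ n"
    using rate_gt_1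
    by (auto simp: power_mult power_divide power_one_over power2_eq_square power_mult_distrib power_even_eq)
  have "\<not> exp (rate ^ n) \<le> exp (rate ^ (2 * n) * (?X t' - ?Y t') - ?c * ?X t')"
    using grid[OF t'(1)] p unfolding deficit_event_def tilt_rate by simp
  then have "rate ^ (2 * n) * (?X t' - ?Y t') - ?c * ?X t' \<le> rate ^ n"
    by simp
  \<comment> \<open>Multiplying by \<open>?r ^ n\<close> removes the factor \<open>rate ^ (2 * n)\<close>, which is the parameter \<open>s\<close> of the moment bound.\<close>
  then have "?r ^ n * (rate ^ (2 * n) * (?X t' - ?Y t') - ?c * ?X t') \<le> ?r ^ n * rate ^ n"
    using rn(2) by (rule mult_left_mono)
  then have "(?r ^ n * rate ^ (2 * n)) * (?X t' - ?Y t') - ?c * ?r ^ n * ?X t' \<le> ?r ^ n * rate ^ n"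
    by (simp only: right_diff_distrib mult_ac)
  then have step: "?X t' - ?Y t' \<le> ?c * ?r ^ n * ?X t' + (1 / rate) ^ n"
    unfolding rn(1,3) by simp
  have "(16 :: real) ^ n * (1 / 64 ^ n) = ?e"
    by (simp add: power_divide[symmetric])
  then have scale: "(16 :: real) ^ n * (1 / 64 ^ n) = ?e" "(16 :: real) ^ Suc n * (1 / 64 ^ n) = 16 * ?e"
    by (simp_all only: power_Suc mult.assoc)
  have X: "\<bar>?X t - ?X t'\<bar> \<le> ?L * ?e"
  proof -
    have "\<bar>?X t - ?X t'\<bar> \<le> 16 ^ n / g\<^sup>2 * (1 / 64 ^ n)"
      using dens_lipschitz[of n u u' t t'] t'(2)
      by (rule order_trans[OF _ mult_left_mono]) simp
    also have "\<dots> = ?L * (16 ^ n * (1 / 64 ^ n))"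
      by simp
    finally show ?thesis unfolding scale .
  qed
  have Y: "\<bar>?Y t - ?Y t'\<bar> \<le> 16 * (?L * ?e)"
  proof -
    have "\<bar>?Y t - ?Y t'\<bar> \<le> 16 ^ Suc n / g\<^sup>2 * (1 / 64 ^ n)"
      using dens_lipschitz[of "Suc n" u u' t t'] t'(2)
      by (rule order_trans[OF _ mult_left_mono]) simp
    also have "\<dots> = ?L * (16 ^ Suc n * (1 / 64 ^ n))"
      by simp
    finally show ?thesis unfolding scale by simp
  qed
  have e: "0 \<le> ?e" "?e \<le> 1"
    by (auto intro!: power_le_one)
  have X0: "0 \<le> ?X t"
    by (rule dens_nonneg)
  have L0: "0 \<le> ?L" "?L * ?e \<le> ?L"
    using e mult_left_mono[of ?e 1 ?L] by auto
  define A where "A = ?c * ?r ^ n"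
  have A0: "0 \<le> A"
    using tilt_const_nonneg rn(2) by (simp add: A_def)
  have "A * ?X t' \<le> A * (?X t + ?L)"
    using X L0 A0 by (intro mult_left_mono) auto
  also have "\<dots> \<le> A * ((1 + ?L) * (1 + ?X t))"
  proof -
    have "x + l \<le> (1 + l) * (1 + x)" if "0 \<le> x" "0 \<le> l" for x l :: real
      using that by (simp add: algebra_simps)
    from mult_left_mono[OF this[OF X0 L0(1)] A0] show ?thesis .
  qed
  finally have A_le: "A * ?X t' \<le> A * (1 + ?L) * (1 + ?X t)"
    by (simp only: mult.assoc)
  have "(1 / rate) ^ n * 1 \<le> (1 / rate) ^ n * (1 + ?X t)" "17 * (?L * ?e) * 1 \<le> 17 * (?L * ?e) * (1 + ?X t)"
    using X0 L0(1) e(1) rate_gt_1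
    by (intro mult_left_mono mult_nonneg_nonneg zero_le_power; simp)+
  moreover have "?X t - ?Y t \<le> 17 * (?L * ?e) + A * ?X t' + (1 / rate) ^ n"
    using step X Y unfolding A_def[symmetric] by linarith
  ultimately have "?X t - ?Y t \<le> A * (1 + ?L) * (1 + ?X t) + (1 / rate) ^ n * (1 + ?X t)
      + 17 * (?L * ?e) * (1 + ?X t)"
    using A_le by simp
  also have "\<dots> = loss n * (1 + ?X t)"
    by (simp add: loss_def A_def algebra_simps)
  finally show ?thesis
    by (simp add: algebra_simps)
qed

section \<open>From positive densities to points of the difference set\<close>

lemma larsson_interval_child:
  assumes "admissible u" "i # w \<in> words"
  shows "larsson_interval a b u (i # w) \<subseteq> larsson_interval a b u w"
  using left_child_bounds[OF assms] unfolding larsson_interval_def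
  by (auto simp del: larsson_left.simps(2) power_Suc list.size)

lemma larsson_level_antimono:
  assumes "admissible u" "m \<le> n"
  shows "larsson_level a b u n \<subseteq> larsson_level a b u m"
  using assms(2)
proof (induction rule: dec_induct)
  case (step n)
  have "larsson_level a b u (Suc n) \<subseteq> larsson_level a b u n"
  proof
    fix x assume "x \<in> larsson_level a b u (Suc n)"
    then obtain w where "w \<in> words" "length w = Suc n" "x \<in> larsson_interval a b u w"
      by (auto simp: larsson_level_def)
    then obtain i v where v: "i # v \<in> words" "length v = n" "x \<in> larsson_interval a b u (i # v)"
      by (cases w) auto
    then have "v \<in> words" "x \<in> larsson_interval a b u v"
      using larsson_interval_child[OF assms(1) v(1)] by (auto simp: Cons_in_words)
    with v(2) show "x \<in> larsson_level a b u n"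
      unfolding larsson_level_def by blast
  qed
  with step.IH show ?case by blast
qed simp

text \<open>If \<open>X\<^sub>m t > 0\<close> then some \<open>J\<^sub>v + t\<close> meets some \<open>J\<^sub>w\<close>, so the compact set of level \<open>m\<close> points \<open>x\<close> with \<open>x + t\<close> of
level \<open>m\<close> in the second set is nonempty.  These sets decrease with \<open>m\<close>.\<close>

lemma mem_difference_if_dens_pos:
  assumes u: "admissible u" "admissible u'" and pos: "\<And>m. N \<le> m \<Longrightarrow> 0 < dens m u u' t"
  shows "t \<in> {y - x | x y. x \<in> larsson_set a b u \<and> y \<in> larsson_set a b u'}"
proof -
  define K where "K m = larsson_level a b u m \<inter> (\<lambda>y. y - t) ` larsson_level a b u' m" for m
  have K_mono: "K n \<subseteq> K m" if "m \<le> n" for m n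
    using larsson_level_antimono[OF u(1) that] larsson_level_antimono[OF u(2) that]
    by (auto simp: K_def)
  have K_hit: "K m \<noteq> {}" if m: "N \<le> m" for m
  proof -
    obtain v w where vw: "v \<in> words_of m" "w \<in> words_of m" "\<bar>t - left u' w + left u v\<bar> < a ^ m"
      using pos[OF m] by (rule dens_posD)
    define x where "x = max (left u v) (left u' w - t)"
    have "x \<in> larsson_interval a b u v" "x + t \<in> larsson_interval a b u' w"
      using vw by (auto simp: x_def larsson_interval_def words_of_def max_def)
    then have "x \<in> larsson_level a b u m" "x + t \<in> larsson_level a b u' m"
      using vw unfolding larsson_level_def words_of_def by blast+
    then have "x \<in> K m"
      by (auto simp: K_def intro!: image_eqI[of _ _ "x + t"])
    then show ?thesis by blast
  qed
  have "\<Inter> (range K) \<noteq> {}"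
  proof (rule compact_nest)
    show "compact (K m)" for m
      unfolding K_def by (intro compact_Int compact_continuous_image continuous_intros compact_larsson_level)
    show "K m \<noteq> {}" for m
      using K_hit[of "max m N"] K_mono[of m "max m N"] by auto
  qed (use K_mono in auto)
  then obtain x where x: "\<And>m. x \<in> K m" by blast
  have "x \<in> larsson_level a b u m \<and> x + t \<in> larsson_level a b u' m" for m
    using x[of m] by (auto simp: K_def)
  then have "x \<in> larsson_set a b u" "x + t \<in> larsson_set a b u'"
    by (simp_all add: larsson_set_def)
  then show ?thesis
    by (intro CollectI exI[of _ x] exI[of _ "x + t"]) simp
qed

text \<open>Choose \<open>n\<close> so late that the remaining losses sum to less than \<open>1 / 20\<close>.  Having integral one, \<open>X\<^sub>n\<close> is at
least \<open>1 / 4\<close> somewhere, hence above \<open>1 / 8\<close> on an interval.  There \<open>1 + X\<^sub>m\<close> never falls below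
\<open>(1 + 1 / 8) * (1 - 1 / 20) > 1\<close>.\<close>

lemma contains_interval_if_eventually:
  assumes u: "admissible u" "admissible u'"
    and ev: "\<forall>\<^sub>F n in sequentially. \<forall>t. \<bar>t\<bar> \<le> 1 \<longrightarrow>
      (1 + dens n u u' t) * (1 - loss n) \<le> 1 + dens (Suc n) u u' t"
  shows "contains_interval (larsson_set a b u, larsson_set a b u')"
proof -
  obtain N where N: "\<And>n t. N \<le> n \<Longrightarrow> \<bar>t\<bar> \<le> 1 \<Longrightarrow>
      (1 + dens n u u' t) * (1 - loss n) \<le> 1 + dens (Suc n) u u' t"
    using ev by (auto simp: eventually_sequentially)
  obtain N' where N': "\<And>n m. N' \<le> n \<Longrightarrow> norm (sum loss {n..<m}) < 1 / 20"
    using summable_loss[unfolded summable_Cauchy, rule_format, of "1 / 20"] by auto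
  define n where "n = max N N'"
  have tail: "sum loss {n..<m} < 1 / 20" for m
    using N'[of n m] by (auto simp: n_def)
  obtain t0 where t0: "\<bar>t0\<bar> < 1" "1 / 4 \<le> dens n u u' t0"
    using ex_dens_large[OF u] by blast
  have "open ({-1<..<1} \<inter> dens n u u' -` {1 / 8<..})"
    by (intro open_Int open_vimage continuous_dens) auto
  moreover have "t0 \<in> {-1<..<1} \<inter> dens n u u' -` {1 / 8<..}"
    using t0 by auto
  ultimately obtain e where e: "0 < e" "cball t0 e \<subseteq> {-1<..<1} \<inter> dens n u u' -` {1 / 8<..}"
    using open_contains_cball by blast
  have pos: "0 < dens m u u' t" if t: "t \<in> {t0 - e..t0 + e}" and m: "n \<le> m" for t m
  proof -
    have "t \<in> cball t0 e"
      using t by (simp add: cball_eq_atLeastAtMost)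
    then have "t \<in> {-1<..<1} \<inter> dens n u u' -` {1 / 8<..}"
      using e(2) by blast
    then have t1: "\<bar>t\<bar> \<le> 1" "1 / 8 < dens n u u' t"
      by auto
    have "(1 + dens n u u' t) * (1 - sum loss {n..<m}) \<le> 1 + dens m u u' t"
      using m
    proof (induction rule: dec_induct)
      case (step m)
      have "sum loss {n..<Suc m} = sum loss {n..<m} + loss m"
        using step.hyps by simp
      moreover have "loss m \<le> sum loss {n..<Suc m}"
        using step.hyps by (intro member_le_sum loss_nonneg) auto
      moreover have "0 \<le> sum loss {n..<m}"
        by (intro sum_nonneg loss_nonneg)
      ultimately have "1 - sum loss {n..<Suc m} \<le> (1 - sum loss {n..<m}) * (1 - loss m)" "0 \<le> 1 - loss m"
        using tail[of "Suc m"] loss_nonneg[of m] by (auto simp: algebra_simps)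
      then have "(1 + dens n u u' t) * (1 - sum loss {n..<Suc m})
          \<le> (1 + dens n u u' t) * ((1 - sum loss {n..<m}) * (1 - loss m))"
        using dens_nonneg[of n u u' t] by (intro mult_left_mono) auto
      also have "\<dots> \<le> (1 + dens m u u' t) * (1 - loss m)"
        unfolding mult.assoc[symmetric] using step.IH \<open>0 \<le> 1 - loss m\<close> by (rule mult_right_mono)
      also have "\<dots> \<le> 1 + dens (Suc m) u u' t"
        using step.hyps t1 by (intro N) (auto simp: n_def)
      finally show ?case .
    qed simp
    moreover have "(1 + 1 / 8) * (1 - 1 / 20) \<le> (1 + dens n u u' t) * (1 - sum loss {n..<m})"
      using t1 tail[of m] by (intro mult_mono) auto
    ultimately show ?thesis by simp
  qed
  have "{t0 - e..t0 + e} \<subseteq> {y - x | x y. x \<in> larsson_set a b u \<and> y \<in> larsson_set a b u'}"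
    using mem_difference_if_dens_pos[OF u] pos by blast
  then show ?thesis
    unfolding contains_interval_def fst_conv snd_conv using e(1)
    by (intro exI[of _ "t0 - e"] exI[of _ "t0 + e"]) simp
qed

lemma AE_contains_interval:
  "AE p in shifts2. contains_interval (larsson_set a b (fst p), larsson_set a b (snd p))"
  using AE_shifts2 AE_eventually_no_deficit AE_space
proof eventually_elim
  case (elim p)
  obtain u u' where p: "p = (u, u')" by (cases p)
  have "admissible u" "admissible u'"
    using elim(1)[THEN spec, of 1] elim(1)[THEN spec, of 2] by (simp_all add: p)
  moreover have "\<forall>\<^sub>F n in sequentially. \<forall>t. \<bar>t\<bar> \<le> 1 \<longrightarrow>
      (1 + dens n u u' t) * (1 - loss n) \<le> 1 + dens (Suc n) u u' t"
    using elim(2) by (rule eventually_mono) (use elim(3) in \<open>auto simp: p intro: dens_Suc_lower\<close>)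
  ultimately show ?case
    unfolding p fst_conv snd_conv by (rule contains_interval_if_eventually)
qed

end

section \<open>Measurability of containing an interval\<close>

lemma space_compacts: "space compacts = {K. compact K}"
  unfolding compacts_def by (rule space_measure_of) auto

lemma compacts_hit_sets: "open G \<Longrightarrow> {K. compact K \<and> K \<inter> G \<noteq> {}} \<in> sets compacts"
  unfolding compacts_def by (subst sets_measure_of) auto

lemma pred_compacts_hit:
  assumes "f \<in> N \<rightarrow>\<^sub>M compacts" "open G"
  shows "Measurable.pred N (\<lambda>x. f x \<inter> G \<noteq> {})"
proof -
  have "{x \<in> space N. f x \<inter> G \<noteq> {}} = f -` {K. compact K \<and> K \<inter> G \<noteq> {}} \<inter> space N"
    using measurable_space[OF assms(1)] by (auto simp: space_compacts)
  also have "\<dots> \<in> sets N"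
    using assms(1) compacts_hit_sets[OF assms(2)] by (rule measurable_sets)
  finally show ?thesis by (simp add: pred_def)
qed

lemma closed_difference_set:
  fixes K K' :: "real set"
  assumes "compact K" "compact K'"
  shows "closed {y - x | x y. x \<in> K \<and> y \<in> K'}"
proof -
  have "{y - x | x y. x \<in> K \<and> y \<in> K'} = {y - x | y x. y \<in> K' \<and> x \<in> K}"
    by blast
  then show ?thesis
    using compact_imp_closed[OF compact_differences[OF assms(2,1)]] by (simp only:)
qed

text \<open>By compactness it suffices to approximate the two points; rational centres make the condition a countable
combination of hitting events.\<close>

lemma mem_difference_iff:
  fixes K K' :: "real set"
  assumes "compact K" "compact K'"
  shows "t \<in> {y - x | x y. x \<in> K \<and> y \<in> K'} \<longleftrightarrow>
    (\<forall>n. \<exists>r :: rat. K \<inter> ball (of_rat r) (inverse (Suc n)) \<noteq> {} \<and> K' \<inter> ball (of_rat r + t) (inverse (Suc n)) \<noteq> {})"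
    (is "?l \<longleftrightarrow> ?r")
proof
  assume ?l
  then obtain x where x: "x \<in> K" "x + t \<in> K'" by force
  show ?r
  proof
    fix n
    obtain r where "x - inverse (Suc n) < of_rat r" "of_rat r < x"
      using of_rat_dense[of "x - inverse (Suc n)" x] by auto
    then have "x \<in> ball (of_rat r) (inverse (Suc n))" "x + t \<in> ball (of_rat r + t) (inverse (Suc n))"
      by (auto simp: dist_real_def)
    with x show "\<exists>r :: rat. K \<inter> ball (of_rat r) (inverse (Suc n)) \<noteq> {}
        \<and> K' \<inter> ball (of_rat r + t) (inverse (Suc n)) \<noteq> {}"
      by (intro exI[of _ r]) blast
  qed
next
  assume R: ?r
  let ?D = "{y - x | x y. x \<in> K \<and> y \<in> K'}"
  have "closed ?D"
    using assms(1,2) by (rule closed_difference_set)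
  moreover have "t \<in> closure ?D"
    unfolding closure_approachable
  proof (intro allI impI)
    fix e :: real assume "0 < e"
    then obtain n where n: "inverse (real (Suc n)) < e / 2"
      using reals_Archimedean[of "e / 2"] by auto
    obtain r x y where "x \<in> K" "y \<in> K'" "dist (of_rat r) x < inverse (Suc n)"
      "dist (of_rat r + t) y < inverse (Suc n)"
      using R[rule_format, of n] by (auto simp: ball_def)
    then have "y - x \<in> ?D" "dist (y - x) t < e"
      using n by (auto simp: dist_real_def)
    then show "\<exists>d\<in>?D. dist d t < e" by blast
  qed
  ultimately show ?l by (simp add: closure_closed)
qed

lemma Icc_subset_difference_iff:
  fixes K K' :: "real set" and p q :: real
  assumes "compact K" "compact K'" "p < q"
  shows "{p..q} \<subseteq> {y - x | x y. x \<in> K \<and> y \<in> K'} \<longleftrightarrow>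
    (\<forall>s :: rat. p < of_rat s \<and> of_rat s < q \<longrightarrow> of_rat s \<in> {y - x | x y. x \<in> K \<and> y \<in> K'})"
    (is "_ \<subseteq> ?D \<longleftrightarrow> ?r")
proof
  assume R: ?r
  have "closed ?D"
    using assms(1,2) by (rule closed_difference_set)
  have "{p<..<q} \<subseteq> closure ({p<..<q} \<inter> range of_rat)"
  proof
    fix t assume t: "t \<in> {p<..<q}"
    show "t \<in> closure ({p<..<q} \<inter> range of_rat)"
      unfolding closure_approachable
    proof (intro allI impI)
      fix e :: real assume "0 < e"
      then obtain s where "max p (t - e) < of_rat s" "of_rat s < t"
        using t of_rat_dense[of "max p (t - e)" t] by auto
      then show "\<exists>y\<in>{p<..<q} \<inter> range of_rat. dist y t < e"
        using t by (intro bexI[of _ "of_rat s"]) (auto simp: dist_real_def)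
    qed
  qed
  also have "\<dots> \<subseteq> ?D"
    using R by (intro closure_minimal \<open>closed ?D\<close>) auto
  finally have "closure {p<..<q} \<subseteq> ?D"
    using \<open>closed ?D\<close> by (rule closure_minimal)
  then show "{p..q} \<subseteq> ?D"
    using assms(3) by (simp add: closure_greaterThanLessThan)
next
  assume L: "{p..q} \<subseteq> ?D"
  show ?r
    by (intro allI impI subsetD[OF L]) simp
qed

lemma contains_interval_iff_rat:
  "contains_interval K \<longleftrightarrow> (\<exists>p q :: rat. p < q \<and>
     {of_rat p..of_rat q} \<subseteq> {y - x | x y. x \<in> fst K \<and> y \<in> snd K})"
proof
  assume "contains_interval K"
  then obtain c d where cd: "c < d" "{c..d} \<subseteq> {y - x | x y. x \<in> fst K \<and> y \<in> snd K}"
    unfolding contains_interval_def by blast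
  obtain p :: rat where p: "c < of_rat p" "of_rat p < d"
    using of_rat_dense[OF cd(1)] by blast
  obtain q :: rat where q: "of_rat p < (of_rat q :: real)" "of_rat q < d"
    using of_rat_dense[OF p(2)] by blast
  have "{of_rat p..of_rat q} \<subseteq> {c..d}"
    using p q by auto
  then have "{of_rat p..of_rat q} \<subseteq> {y - x | x y. x \<in> fst K \<and> y \<in> snd K}"
    using cd(2) by (rule order_trans)
  moreover have "p < q"
    using q(1) by (simp add: of_rat_less)
  ultimately show "\<exists>p q :: rat. p < q \<and> {of_rat p..of_rat q} \<subseteq> {y - x | x y. x \<in> fst K \<and> y \<in> snd K}"
    by blast
next
  assume "\<exists>p q :: rat. p < q \<and> {of_rat p..of_rat q} \<subseteq> {y - x | x y. x \<in> fst K \<and> y \<in> snd K}"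
  then obtain p q :: rat where "p < q" "{of_rat p..of_rat q} \<subseteq> {y - x | x y. x \<in> fst K \<and> y \<in> snd K}"
    by blast
  then show "contains_interval K"
    unfolding contains_interval_def
    by (intro exI[of _ "real_of_rat p"] exI[of _ "real_of_rat q"]) (simp add: of_rat_less)
qed

text \<open>Interval endpoints and the points tested inside the interval may be taken rational, because the
difference of two compact sets is closed.\<close>

lemma pred_contains_interval: "Measurable.pred (compacts \<Otimes>\<^sub>M compacts) contains_interval"
proof -
  let ?P = "\<lambda>K. \<exists>p q :: rat. p < q \<and> (\<forall>s :: rat. real_of_rat p < of_rat s \<and> real_of_rat s < of_rat q \<longrightarrow>
    (\<forall>n. \<exists>r :: rat. fst K \<inter> ball (real_of_rat r) (inverse (Suc n)) \<noteq> {} \<and>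
      snd K \<inter> ball (real_of_rat r + of_rat s) (inverse (Suc n)) \<noteq> {}))"
  have hit: "Measurable.pred (compacts \<Otimes>\<^sub>M compacts) (\<lambda>K :: real set \<times> real set. fst K \<inter> ball x e \<noteq> {})"
    "Measurable.pred (compacts \<Otimes>\<^sub>M compacts) (\<lambda>K :: real set \<times> real set. snd K \<inter> ball x e \<noteq> {})" for x e :: real
    by (rule pred_compacts_hit[OF measurable_fst open_ball] pred_compacts_hit[OF measurable_snd open_ball])+
  have "Measurable.pred (compacts \<Otimes>\<^sub>M compacts) ?P"
    by (intro pred_intros_countable pred_intros_logic(3,4) hit) simp_all
  moreover have "contains_interval K \<longleftrightarrow> ?P K" if "K \<in> space (compacts \<Otimes>\<^sub>M compacts)" for K
  proof -
    have c: "compact (fst K)" "compact (snd K)"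
      using that by (auto simp: space_pair_measure space_compacts)
    have "p < q \<and> {of_rat p..of_rat q} \<subseteq> {y - x | x y. x \<in> fst K \<and> y \<in> snd K} \<longleftrightarrow>
        p < q \<and> (\<forall>s :: rat. real_of_rat p < of_rat s \<and> real_of_rat s < of_rat q \<longrightarrow>
          (\<forall>n. \<exists>r :: rat. fst K \<inter> ball (real_of_rat r) (inverse (Suc n)) \<noteq> {} \<and>
            snd K \<inter> ball (real_of_rat r + of_rat s) (inverse (Suc n)) \<noteq> {}))" for p q :: rat
    proof (rule conj_cong[OF refl])
      assume "p < q"
      then have "real_of_rat p < of_rat q" by (simp add: of_rat_less)
      from Icc_subset_difference_iff[OF c this]
      show "{of_rat p..of_rat q} \<subseteq> {y - x | x y. x \<in> fst K \<and> y \<in> snd K} \<longleftrightarrow>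
        (\<forall>s :: rat. real_of_rat p < of_rat s \<and> real_of_rat s < of_rat q \<longrightarrow>
          (\<forall>n. \<exists>r :: rat. fst K \<inter> ball (real_of_rat r) (inverse (Suc n)) \<noteq> {} \<and>
            snd K \<inter> ball (real_of_rat r + of_rat s) (inverse (Suc n)) \<noteq> {}))"
        by (simp only: mem_difference_iff[OF c])
    qed
    then show ?thesis
      unfolding contains_interval_iff_rat by (intro ex_cong1)
  qed
  ultimately show ?thesis
    by (rule measurable_cong[THEN iffD2, rotated])
qed

section \<open>Random sets with the given laws\<close>

text \<open>Independence makes the joint law of \<open>(C1, C2)\<close> the image of the product of two copies of \<open>larsson_shifts a b\<close>,
and a measurable event holds almost surely for one iff it does for the other.\<close>

theorem theorem1:
  fixes a b :: real
    and M :: "'w measure"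
    and C1 C2 :: "'w \<Rightarrow> real set"
  assumes "a > 1 / 4" and "b \<ge> 0" and "3 * a + 2 * b < 1"
    and "prob_space M"
    and "prob_space.indep_var M compacts C1 compacts C2"
    and "distr M compacts C1 = larsson_law a b"
    and "distr M compacts C2 = larsson_law a b"
  shows "AE \<omega> in M. \<exists>c d. c < d \<and> {c..d} \<subseteq> {y - x | x y. x \<in> C1 \<omega> \<and> y \<in> C2 \<omega>}"
proof -
  interpret prob_space M by fact
  interpret larsson a b by unfold_locales fact+
  let ?L = "larsson_set a b" and ?CC = "compacts \<Otimes>\<^sub>M compacts"
  have rv: "random_variable compacts C1" "random_variable compacts C2"
    and joint: "distr M compacts C1 \<Otimes>\<^sub>M distr M compacts C2 = distr M ?CC (\<lambda>\<omega>. (C1 \<omega>, C2 \<omega>))"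
    using assms(5) unfolding indep_var_distribution_eq by auto
  have "distr M ?CC (\<lambda>\<omega>. (C1 \<omega>, C2 \<omega>)) = larsson_law a b \<Otimes>\<^sub>M larsson_law a b"
    using joint assms(6,7) by simp
  also have "\<dots> = distr shifts2 ?CC (\<lambda>(u, u'). (?L u, ?L u'))"
    unfolding larsson_law_def
  proof (rule pair_measure_distr[OF larsson_set_measurable larsson_set_measurable])
    have "prob_space (distr shifts compacts ?L)"
      by (intro prob_space.prob_space_distr prob_space_shifts larsson_set_measurable)
    then show "sigma_finite_measure (distr shifts compacts ?L)"
      by (rule prob_space_imp_sigma_finite)
  qed
  finally have law: "distr M ?CC (\<lambda>\<omega>. (C1 \<omega>, C2 \<omega>)) = distr shifts2 ?CC (\<lambda>p. (?L (fst p), ?L (snd p)))"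
    by (simp add: case_prod_unfold)
  have [measurable]: "?L \<in> shifts \<rightarrow>\<^sub>M compacts"
    by (rule larsson_set_measurable)
  note [measurable] = rv
  have ev: "{K \<in> space ?CC. contains_interval K} \<in> sets ?CC"
    using pred_contains_interval by (simp add: pred_def)
  have "AE K in distr shifts2 ?CC (\<lambda>p. (?L (fst p), ?L (snd p))). contains_interval K"
    using AE_contains_interval ev by (subst AE_distr_iff) auto
  then have "AE \<omega> in M. contains_interval (C1 \<omega>, C2 \<omega>)"
    unfolding law[symmetric] using ev by (subst (asm) AE_distr_iff) auto
  then show ?thesis
    by (simp add: contains_interval_def)
qed

end
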